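(* Let $G$ be a topological group and $f\in C(G)$. The following conditions are equivalent: (1) $f\in\mathrm{SUC}(G)$. (2) $f=m_{v,\psi}$ for some continuous co-representation $h\colon G\to\mathrm{Iso}(V)$ on a Banach space $V$, some $v\in V$ and $\psi\in V^*$, with the property that $\varphi$ is norm $G$-continuous for every $\varphi$ in the weak$^*$ closure $\mathrm{cl}_{w^*}(G\psi)$. Moreover, one can assume in (2) that $\mathrm{cl}_{w^*}(G\psi)$ separates points of $V$.
   Context: $C(G)$ is the algebra of bounded continuous real valued functions on $G$. A $G$-space is a Tychonoff space with a continuous left action of $G$. A compact $G$-space $Y$, with its unique compatible uniformity $\mu_Y$, is SUC if for every $y_0\in Y$ and every $\varepsilon\in\mu_Y$ there is a neighborhood $U$ of $e$ such that $(guy_0,gy_0)\in\varepsilon$ for all $g\in G$, $u\in U$. $f\in C(G)$ belongs to $\mathrm{SUC}(G)$ if $f=F\circ\nu$ for some compact SUC $G$-space $Y$, some continuous $G$-equivariant map $\nu\colon G\to Y$ with dense image ($G$ acting on itself by left translations) and some continuous $F\colon Y\to\mathbb{R}$. For a real Banach space $V$, $\mathrm{Iso}(V)$ is the group of linear surjective isometries of $V$ with the strong operator topology. A co-representation is a map $h\colon G\to\mathrm{Iso}(V)$ with $h(g_1g_2)=h(g_2)h(g_1)$; put $vg:=h(g)(v)$ (a right action). The dual left action of $G$ on $V^*$ is $(g\psi)(v):=\psi(vg)$, and $G\psi=\{g\psi: g\in G\}$. For $v\in V$, $\psi\in V^*$ the matrix coefficient is $m_{v,\psi}\colon G\to\mathbb{R}$,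 $m_{v,\psi}(g)=\psi(vg)=\langle v,g\psi\rangle$. A vector $\varphi\in V^*$ is norm $G$-continuous if the orbit map $G\to V^*$, $g\mapsto g\varphi$, is continuous for the norm of $V^*$. *)

theory Defs
  imports "HOL-Analysis.Analysis"
begin

text \<open>
  A topological group is a type \<open>'g\<close> of class \<^class>\<open>topological_group_add\<close>. That class
  does not assume commutativity; the group operation is written \<open>+\<close> and the
  neutral element \<open>0\<close>. The algebra \<open>C(G)\<close> is the type \<open>'g \<Rightarrow>\<^sub>C real\<close>.
\<close>

subsection \<open>SUC functions\<close>

definition G_space :: "'y topology \<Rightarrow> ('g::topological_group_add \<Rightarrow> 'y \<Rightarrow> 'y) \<Rightarrow> bool" where
  "G_space Y act \<longleftrightarrow>
     completely_regular_space Y \<and> Hausdorff_space Y \<and>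
     continuous_map (prod_topology euclidean Y) Y (\<lambda>(g, y). act g y) \<and>
     (\<forall>y\<in>topspace Y. act 0 y = y) \<and>
     (\<forall>g h. \<forall>y\<in>topspace Y. act (g + h) y = act g (act h y))"

text \<open>
  The entourages of a uniformity are the sets \<open>{p. E p}\<close> with \<open>eventually E \<mu>\<close>. The
  axioms are those of \<^class>\<open>uniform_space\<close>, relativised to \<^term>\<open>topspace Y\<close>.
\<close>

definition compatible_uniformity :: "'y topology \<Rightarrow> ('y \<times> 'y) filter \<Rightarrow> bool" where
  "compatible_uniformity Y \<mu> \<longleftrightarrow>
     eventually (\<lambda>p. p \<in> topspace Y \<times> topspace Y) \<mu> \<and>
     (\<forall>E. eventually E \<mu> \<longrightarrow> (\<forall>x\<in>topspace Y. E (x, x))) \<and>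
     (\<forall>E. eventually E \<mu> \<longrightarrow> eventually (\<lambda>(x, y). E (y, x)) \<mu>) \<and>
     (\<forall>E. eventually E \<mu> \<longrightarrow>
        (\<exists>D. eventually D \<mu> \<and> (\<forall>x y z. D (x, y) \<longrightarrow> D (y, z) \<longrightarrow> E (x, z)))) \<and>
     (\<forall>U. openin Y U \<longleftrightarrow>
        U \<subseteq> topspace Y \<and> (\<forall>x\<in>U. eventually (\<lambda>(x', y). x' = x \<longrightarrow> y \<in> U) \<mu>))"

text \<open>
  A compact Hausdorff space has exactly one compatible uniformity, so the
  existential quantifier over \<open>\<mu>\<close> only names it.
\<close>

definition compact_SUC_space :: "'y topology \<Rightarrow> ('g::topological_group_add \<Rightarrow> 'y \<Rightarrow> 'y) \<Rightarrow> bool" where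
  "compact_SUC_space Y act \<longleftrightarrow>
     compact_space Y \<and> G_space Y act \<and>
     (\<exists>\<mu>. compatible_uniformity Y \<mu> \<and>
        (\<forall>y0\<in>topspace Y. \<forall>E. eventually E \<mu> \<longrightarrow>
           (\<forall>\<^sub>F u in nhds 0. \<forall>g. E (act (g + u) y0, act g y0))))"

definition SUC_factorization ::
  "'y topology \<Rightarrow> ('g::topological_group_add \<Rightarrow> 'y \<Rightarrow> 'y) \<Rightarrow> ('g \<Rightarrow> 'y) \<Rightarrow> ('y \<Rightarrow> real)
    \<Rightarrow> ('g \<Rightarrow>\<^sub>C real) \<Rightarrow> bool" where
  "SUC_factorization Y act \<nu> F f \<longleftrightarrow>
     compact_SUC_space Y act \<and>
     continuous_map euclidean Y \<nu> \<and>
     (\<forall>g x. \<nu> (g + x) = act g (\<nu> x)) \<and>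
     Y closure_of (range \<nu>) = topspace Y \<and>
     continuous_map Y euclideanreal F \<and>
     apply_bcontfun f = F \<circ> \<nu>"

text \<open>
  HOL cannot quantify existentially over types, so \<open>Y\<close> ranges over the spaces
  carried by subsets of the type \<open>'g set set\<close>. There is no loss of generality: if \<open>\<nu>\<close>
  maps \<open>G\<close> densely into a compact Hausdorff space, then a point \<open>y\<close> is determined by
  the family of all sets \<open>A\<close> such that \<open>y\<close> lies in the closure of \<open>\<nu> ` A\<close>.
\<close>

definition SUC :: "('g::topological_group_add \<Rightarrow>\<^sub>C real) set" where
  "SUC = {f. \<exists>(Y :: 'g set set topology) act \<nu> F. SUC_factorization Y act \<nu> F f}"

subsection \<open>Banach spaces with a carrier\<close>

text \<open>
  A Banach space is a linear subspace \<open>V\<close> of a type of class \<^class>\<open>real_vector\<close> together with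
  a norm \<open>N\<close> on \<open>V\<close>. The ambient type carries only its vector space structure, and
  the values of \<open>N\<close> outside \<open>V\<close> are irrelevant. Linear maps and functionals are defined on \<open>V\<close>
  only, that is, they are \<^const>\<open>extensional\<close>.
\<close>

text \<open>
  The cut-off makes the distance nonnegative and symmetric on the whole type, as the
  locale \<^locale>\<open>Metric_space\<close> demands.
\<close>

definition dist_on :: "'a set \<Rightarrow> ('a \<Rightarrow> 'a \<Rightarrow> real) \<Rightarrow> 'a \<Rightarrow> 'a \<Rightarrow> real" where
  "dist_on M d x y = (if x \<in> M \<and> y \<in> M then d x y else 0)"

definition norm_dist :: "'v::real_vector set \<Rightarrow> ('v \<Rightarrow> real) \<Rightarrow> 'v \<Rightarrow> 'v \<Rightarrow> real" where
  "norm_dist V N = dist_on V (\<lambda>x y. N (x - y))"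

definition banach_space_on :: "'v::real_vector set \<Rightarrow> ('v \<Rightarrow> real) \<Rightarrow> bool" where
  "banach_space_on V N \<longleftrightarrow>
     subspace V \<and>
     (\<forall>x\<in>V. 0 \<le> N x) \<and>
     (\<forall>x\<in>V. N x = 0 \<longleftrightarrow> x = 0) \<and>
     (\<forall>c. \<forall>x\<in>V. N (c *\<^sub>R x) = \<bar>c\<bar> * N x) \<and>
     (\<forall>x\<in>V. \<forall>y\<in>V. N (x + y) \<le> N x + N y) \<and>
     Metric_space.mcomplete V (norm_dist V N)"

definition linear_within :: "'v::real_vector set \<Rightarrow> ('v \<Rightarrow> 'w::real_vector) \<Rightarrow> bool" where
  "linear_within V T \<longleftrightarrow>
     (\<forall>x\<in>V. \<forall>y\<in>V. T (x + y) = T x + T y) \<and> (\<forall>c. \<forall>x\<in>V. T (c *\<^sub>R x) = c *\<^sub>R T x)"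

definition Iso :: "'v::real_vector set \<Rightarrow> ('v \<Rightarrow> real) \<Rightarrow> ('v \<Rightarrow> 'v) set" where
  "Iso V N = {T \<in> extensional V. linear_within V T \<and> T ` V = V \<and> (\<forall>v\<in>V. N (T v) = N v)}"

definition strong_operator_topology ::
  "'v::real_vector set \<Rightarrow> ('v \<Rightarrow> real) \<Rightarrow> ('v \<Rightarrow> 'v) topology" where
  "strong_operator_topology V N =
     subtopology (product_topology (\<lambda>_. Metric_space.mtopology V (norm_dist V N)) V) (Iso V N)"

definition dual :: "'v::real_vector set \<Rightarrow> ('v \<Rightarrow> real) \<Rightarrow> ('v \<Rightarrow> real) set" where
  "dual V N = {\<phi> \<in> extensional V. linear_within V \<phi> \<and> (\<exists>B. \<forall>v\<in>V. \<bar>\<phi> v\<bar> \<le> B * N v)}"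

definition dual_norm :: "'v::real_vector set \<Rightarrow> ('v \<Rightarrow> real) \<Rightarrow> ('v \<Rightarrow> real) \<Rightarrow> real" where
  "dual_norm V N \<phi> = (SUP v\<in>{v\<in>V. N v \<le> 1}. \<bar>\<phi> v\<bar>)"

definition dual_norm_topology ::
  "'v::real_vector set \<Rightarrow> ('v \<Rightarrow> real) \<Rightarrow> ('v \<Rightarrow> real) topology" where
  "dual_norm_topology V N =
     Metric_space.mtopology (dual V N)
       (dist_on (dual V N) (\<lambda>\<phi> \<theta>. dual_norm V N (\<lambda>v. \<phi> v - \<theta> v)))"

definition weak_star_topology ::
  "'v::real_vector set \<Rightarrow> ('v \<Rightarrow> real) \<Rightarrow> ('v \<Rightarrow> real) topology" where
  "weak_star_topology V N = subtopology (product_topology (\<lambda>_. euclideanreal) V) (dual V N)"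

subsection \<open>Co-representations\<close>

text \<open>The right action is \<open>v g = h g v\<close>.\<close>

definition continuous_corep ::
  "'v::real_vector set \<Rightarrow> ('v \<Rightarrow> real) \<Rightarrow> ('g::topological_group_add \<Rightarrow> 'v \<Rightarrow> 'v) \<Rightarrow> bool" where
  "continuous_corep V N h \<longleftrightarrow>
     (\<forall>g. h g \<in> Iso V N) \<and>
     (\<forall>g1 g2. h (g1 + g2) = compose V (h g2) (h g1)) \<and>
     continuous_map euclidean (strong_operator_topology V N) h"

definition dual_action :: "'v set \<Rightarrow> ('g \<Rightarrow> 'v \<Rightarrow> 'v) \<Rightarrow> 'g \<Rightarrow> ('v \<Rightarrow> real) \<Rightarrow> 'v \<Rightarrow> real" where
  "dual_action V h g \<psi> = (\<lambda>v\<in>V. \<psi> (h g v))"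

definition matrix_coefficient :: "('g \<Rightarrow> 'v \<Rightarrow> 'v) \<Rightarrow> 'v \<Rightarrow> ('v \<Rightarrow> real) \<Rightarrow> 'g \<Rightarrow> real" where
  "matrix_coefficient h v \<psi> g = \<psi> (h g v)"

definition orbit_closure ::
  "'v::real_vector set \<Rightarrow> ('v \<Rightarrow> real) \<Rightarrow> ('g \<Rightarrow> 'v \<Rightarrow> 'v) \<Rightarrow> ('v \<Rightarrow> real) \<Rightarrow> ('v \<Rightarrow> real) set" where
  "orbit_closure V N h \<psi> =
     weak_star_topology V N closure_of (range (\<lambda>g. dual_action V h g \<psi>))"

definition norm_G_continuous ::
  "'v::real_vector set \<Rightarrow> ('v \<Rightarrow> real) \<Rightarrow> ('g::topological_group_add \<Rightarrow> 'v \<Rightarrow> 'v)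
    \<Rightarrow> ('v \<Rightarrow> real) \<Rightarrow> bool" where
  "norm_G_continuous V N h \<phi> \<longleftrightarrow>
     continuous_map euclidean (dual_norm_topology V N) (\<lambda>g. dual_action V h g \<phi>)"

definition separates_points :: "('v \<Rightarrow> real) set \<Rightarrow> 'v set \<Rightarrow> bool" where
  "separates_points \<Phi> V \<longleftrightarrow> (\<forall>v\<in>V. \<forall>w\<in>V. v \<noteq> w \<longrightarrow> (\<exists>\<phi>\<in>\<Phi>. \<phi> v \<noteq> \<phi> w))"

definition SUC_representation ::
  "'v::real_vector set \<Rightarrow> ('v \<Rightarrow> real) \<Rightarrow> ('g::topological_group_add \<Rightarrow> 'v \<Rightarrow> 'v)
    \<Rightarrow> 'v \<Rightarrow> ('v \<Rightarrow> real) \<Rightarrow> ('g \<Rightarrow>\<^sub>C real) \<Rightarrow> bool" where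
  "SUC_representation V N h v \<psi> f \<longleftrightarrow>
     banach_space_on V N \<and> continuous_corep V N h \<and>
     v \<in> V \<and> \<psi> \<in> dual V N \<and>
     (\<forall>\<phi>\<in>orbit_closure V N h \<psi>. norm_G_continuous V N h \<phi>) \<and>
     apply_bcontfun f = matrix_coefficient h v \<psi>"

text \<open>
  To assert the existence of a Banach space one must fix an ambient vector space
  type; \<open>'g \<Rightarrow>\<^sub>C real\<close> is large enough. Indeed, if the orbit closure of \<open>\<psi>\<close> separates the
  points of \<open>V\<close>, then sending \<open>v\<close> to its matrix coefficient with \<open>\<psi>\<close> embeds \<open>V\<close>
  linearly (not isometrically) into \<open>C(G)\<close>.
\<close>

end

theory Submission
  imports Defs
begin

text \<open>
  Both conditions are equivalent to an intrinsic one: the left translates of \<open>f\<close> depend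
  norm continuously on the group element, and every pointwise limit \<open>k\<close> of the functions
  \<open>g \<mapsto> f (g + x)\<close> satisfies \<open>k (g + u) \<rightarrow> k g\<close> as \<open>u \<rightarrow> 0\<close>, uniformly in \<open>g\<close>. The set of
  these limits is compact and carries a \<open>G\<close>-action, and it is the image of the compact
  space \<open>Y\<close>, or of the orbit closure of \<open>\<psi>\<close>, under \<open>y \<mapsto> (g \<mapsto> F (g y))\<close>, or \<open>\<phi> \<mapsto> (g \<mapsto> \<phi> (v g))\<close>.
  It serves as \<open>Y\<close> in one direction.

  For the representation, let \<open>M\<close> be the set of pointwise limits of evaluation functionals on
  \<open>C(G)\<close>, with the pseudometric \<open>D(\<phi>, \<theta>) = sup\<^sub>g \<bar>\<phi>(f g) - \<theta>(f g)\<bar>\<close>. A function \<open>w\<close> acts on \<open>M\<close>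
  by \<open>\<phi> \<mapsto> \<phi>(w)\<close>, and \<open>V\<close> consists of the \<open>w\<close> for which this is Hoelder continuous of exponent
  \<open>1/2\<close> and whose translates depend continuously on the group element in the Hoelder norm.
  Functionals in \<open>M\<close> are norm continuous on \<open>V\<close> because their orbit maps are
  \<open>D\<close>-continuous by the intrinsic condition, and the exponent less than \<open>1\<close> is what makes
  \<open>f\<close> itself a continuous vector.
\<close>

section \<open>Pointwise limits of translates\<close>

text \<open>On a function type \<open>closure\<close> refers to pointwise convergence, so this is
  the orbit closure of \<open>f\<close> under right translations in a product of real lines, not a
  norm closure.\<close>

definition right_hull :: "('g::topological_group_add \<Rightarrow>\<^sub>C real) \<Rightarrow> ('g \<Rightarrow> real) set" where
  "right_hull f = closure (range (\<lambda>x g. apply_bcontfun f (g + x)))"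

definition SUC_criterion :: "('g::topological_group_add \<Rightarrow>\<^sub>C real) \<Rightarrow> bool" where
  "SUC_criterion f \<longleftrightarrow>
     (\<forall>\<epsilon>>0. \<forall>\<^sub>F u in nhds 0. \<forall>x. \<bar>apply_bcontfun f (u + x) - apply_bcontfun f x\<bar> < \<epsilon>) \<and>
     (\<forall>k\<in>right_hull f. \<forall>\<epsilon>>0. \<forall>\<^sub>F u in nhds 0. \<forall>g. \<bar>k (g + u) - k g\<bar> < \<epsilon>)"

section \<open>Closures and compactness in products of real lines\<close>

text \<open>The sublevel set of \<open>c\<close> is closed. Bounds are carried over to pointwise
  limits in this way throughout; an identity \<open>a = b\<close> is passed on as
  \<open>\<bar>a - b\<bar> \<le> 0\<close>.\<close>

lemma closure_of_le:
  assumes "continuous_map X euclideanreal c" "\<And>s. s \<in> S \<Longrightarrow> c s \<le> b" "x \<in> X closure_of S"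
  shows "c x \<le> b"
proof -
  have "X closure_of S = X closure_of (topspace X \<inter> S)"
    by (metis closure_of_restrict)
  also have "\<dots> \<subseteq> {x \<in> topspace X. c x \<in> {..b}}"
    using assms(1,2) by (intro closure_of_minimal closedin_continuous_map_preimage[OF assms(1)]) auto
  finally show ?thesis using assms(3) by auto
qed

text \<open>The closure is a closed subset of a product of compact intervals, which is compact by
  Tychonoff.\<close>

lemma compactin_closure_of_bounded:
  fixes B :: "'i \<Rightarrow> real"
  assumes "\<And>s i. s \<in> S \<Longrightarrow> i \<in> I \<Longrightarrow> \<bar>s i\<bar> \<le> B i"
  shows "compactin (product_topology (\<lambda>_. euclideanreal) I)
           (product_topology (\<lambda>_. euclideanreal) I closure_of S)" (is "compactin ?X _")
proof (rule closed_compactin)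
  show "compactin ?X (\<Pi>\<^sub>E i\<in>I. {- B i..B i})"
    unfolding compactin_PiE by simp
  show "?X closure_of S \<subseteq> (\<Pi>\<^sub>E i\<in>I. {- B i..B i})"
  proof
    fix x assume x: "x \<in> ?X closure_of S"
    have ext: "x \<in> extensional I"
      using subsetD[OF closure_of_subset_topspace x] by (simp add: PiE_def)
    have cont: "continuous_map ?X euclideanreal (\<lambda>x. \<bar>x i\<bar>)" if "i \<in> I" for i
      using continuous_map_product_coordinates[OF that, of "\<lambda>_. euclideanreal"]
      by (rule continuous_map_real_abs)
    have "\<bar>x i\<bar> \<le> B i" if "i \<in> I" for i
      using assms that by (intro closure_of_le[OF cont[OF that] _ x])
    then have "x i \<in> {- B i..B i}" if "i \<in> I" for i
      using that by (simp add: abs_le_iff minus_le_iff)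
    with ext show "x \<in> (\<Pi>\<^sub>E i\<in>I. {- B i..B i})"
      by (simp add: PiE_def Pi_def)
  qed
qed (rule closedin_closure_of)

lemma compact_closure_pointwise_bounded:
  fixes S :: "('i \<Rightarrow> real) set"
  assumes "\<And>s i. s \<in> S \<Longrightarrow> \<bar>s i\<bar> \<le> B i"
  shows "compact (closure S)"
  using compactin_closure_of_bounded[of S UNIV B, unfolded euclidean_product_topology] assms
  by simp

lemma continuous_map_fun_euclidean:
  fixes \<Phi> :: "'y \<Rightarrow> 'i \<Rightarrow> real"
  assumes "\<And>i. continuous_map X euclideanreal (\<lambda>y. \<Phi> y i)"
  shows "continuous_map X euclidean \<Phi>"
  using assms continuous_map_componentwise_UNIV[of X "\<lambda>_. euclideanreal" \<Phi>]
  unfolding euclidean_product_topology by blast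

lemma Hausdorff_space_fun_euclidean:
  "Hausdorff_space (euclidean :: ('i \<Rightarrow> real) topology)"
  unfolding euclidean_product_topology[symmetric] Hausdorff_space_product_topology by simp

text \<open>Compact images in a Hausdorff space are closed. This is how each limit of translates of
  \<open>f\<close> acquires a representing point, in a compact \<open>G\<close>-space or in an orbit
  closure.\<close>

lemma continuous_map_image_compact_closure:
  fixes \<Phi> :: "'y \<Rightarrow> 'i \<Rightarrow> real"
  assumes "compactin X K" "continuous_map X euclidean \<Phi>" "S \<subseteq> \<Phi> ` K"
  shows "closure S \<subseteq> \<Phi> ` K"
proof (rule closure_minimal[OF assms(3)])
  show "closed (\<Phi> ` K)"
    using compactin_imp_closedin[OF Hausdorff_space_fun_euclidean image_compactin[OF assms(1,2)]]
    by simp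
qed

lemma continuous_map_eval:
  "continuous_map euclidean euclideanreal (\<lambda>k :: 'i \<Rightarrow> real. k i)"
  using continuous_map_product_coordinates[of i UNIV "\<lambda>_. euclideanreal"]
  unfolding euclidean_product_topology by simp

lemma closure_fun_le:
  fixes c :: "('i \<Rightarrow> real) \<Rightarrow> real"
  assumes "continuous_map euclidean euclideanreal c" "\<And>s. s \<in> S \<Longrightarrow> c s \<le> b" "k \<in> closure S"
  shows "c k \<le> b"
  using closure_of_le[OF assms(1,2)] assms(3) by simp

lemma abs_le_norm_bcontfun: "\<bar>apply_bcontfun w x\<bar> \<le> norm (w :: 'a::topological_space \<Rightarrow>\<^sub>C real)"
  using norm_bounded[of w x] by simp

section \<open>The compact hull of translates\<close>

lemma compact_right_hull: "compact (right_hull f)"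
  unfolding right_hull_def
  by (intro compact_closure_pointwise_bounded[of _ "\<lambda>_. norm f"]) (auto intro: abs_le_norm_bcontfun)

lemma translate_in_right_hull: "(\<lambda>g. apply_bcontfun f (g + x)) \<in> right_hull f"
  unfolding right_hull_def by (rule subsetD[OF closure_subset]) blast

text \<open>Right translation by \<open>u\<close> is pointwise continuous and turns the translate of
  \<open>f\<close> by \<open>x\<close> into the one by \<open>u + x\<close>. It provides the action
  of \<open>G\<close> on the hull.\<close>

lemma right_hull_invariant:
  assumes "k \<in> right_hull f"
  shows "(\<lambda>g. k (g + u)) \<in> right_hull f"
proof -
  let ?T = "\<lambda>(k :: 'a \<Rightarrow> real) g. k (g + u)"
  let ?S = "range (\<lambda>x g. apply_bcontfun f (g + x))"
  have "continuous_map euclidean euclidean ?T"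
    by (intro continuous_map_fun_euclidean continuous_map_eval)
  then have "?T ` closure ?S \<subseteq> closure (?T ` ?S)"
    using continuous_map_image_closure_subset[of euclidean euclidean ?T ?S] by simp
  also have "\<dots> \<subseteq> closure ?S"
  proof (rule closure_mono, clarify)
    fix x
    have "(\<lambda>g. apply_bcontfun f (g + u + x)) = (\<lambda>g. apply_bcontfun f (g + (u + x)))"
      by (simp add: add.assoc)
    then show "(\<lambda>g. apply_bcontfun f (g + u + x)) \<in> ?S" by blast
  qed
  finally show ?thesis using assms unfolding right_hull_def by blast
qed

text \<open>The first clause of the criterion is uniform in \<open>x\<close>, so it holds for all
  translates of \<open>f\<close> with the same \<open>u\<close>. Passing to limits keeps it, with a
  weak inequality.\<close>

lemma right_hull_uniform_left:
  assumes "SUC_criterion f" "\<epsilon> > 0"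
  shows "\<forall>\<^sub>F u in nhds 0. \<forall>k\<in>right_hull f. \<forall>x. \<bar>k (u + x) - k x\<bar> \<le> \<epsilon>"
proof -
  have "\<forall>\<^sub>F u in nhds 0. \<forall>x. \<bar>apply_bcontfun f (u + x) - apply_bcontfun f x\<bar> < \<epsilon>"
    using assms unfolding SUC_criterion_def by blast
  then show ?thesis
  proof eventually_elim
    case (elim u)
    show ?case
    proof (intro ballI allI)
      fix k x assume "k \<in> right_hull f"
      then have k: "k \<in> closure (range (\<lambda>x g. apply_bcontfun f (g + x)))"
        by (simp add: right_hull_def)
      show "\<bar>k (u + x) - k x\<bar> \<le> \<epsilon>"
      proof (rule closure_fun_le[OF _ _ k])
        show "continuous_map euclidean euclideanreal (\<lambda>k. \<bar>k (u + x) - k x\<bar>)"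
          by (intro continuous_map_real_abs continuous_map_diff continuous_map_eval)
        show "\<bar>s (u + x) - s x\<bar> \<le> \<epsilon>" if "s \<in> range (\<lambda>x g. apply_bcontfun f (g + x))" for s
          using elim that by (auto simp: add.assoc intro: less_imp_le)
      qed
    qed
  qed
qed

lemma tendsto_conjugate_0:
  fixes g u0 :: "'g::topological_group_add"
  shows "((\<lambda>u. g + u + - u0 + - g) \<longlongrightarrow> 0) (nhds u0)"
proof -
  have "((\<lambda>u. g + u + - u0 + - g) \<longlongrightarrow> g + u0 + - u0 + - g) (nhds u0)"
    by (intro tendsto_add tendsto_const filterlim_ident)
  then show ?thesis by (simp add: add.assoc)
qed

text \<open>The increment is moved to the left: \<open>g + u\<close> is \<open>g + u0\<close>
  preceded by the conjugate \<open>g + u + - u0 + - g\<close>, which tends to \<open>0\<close>. The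
  resulting equicontinuity of the hull gives joint continuity of the action later.\<close>

lemma right_hull_uniform_at:
  assumes "SUC_criterion f" "\<epsilon> > 0"
  shows "\<forall>\<^sub>F u in nhds u0. \<forall>k\<in>right_hull f. \<bar>k (g + u) - k (g + u0)\<bar> \<le> \<epsilon>"
  using eventually_compose_filterlim[OF right_hull_uniform_left[OF assms] tendsto_conjugate_0[of g u0]]
proof eventually_elim
  case (elim u)
  have "g + u + - u0 + - g + (g + u0) = g + u"
    by (simp add: add.assoc del: add_uminus_conv_diff)
  with elim show ?case by metis
qed

text \<open>This injection carries the hull over to the type \<open>'g set set\<close> demanded by \<^const>\<open>SUC\<close>.\<close>

lemma inj_on_adherent_sets:
  "inj_on (\<lambda>k. {A. k \<in> closure ((\<lambda>x g. apply_bcontfun f (g + x)) ` A)}) (right_hull f)"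
proof (rule inj_onI, rule ccontr)
  let ?\<nu> = "\<lambda>x g. apply_bcontfun f (g + x)"
  fix k l assume k: "k \<in> right_hull f"
    and eq: "{A. k \<in> closure (?\<nu> ` A)} = {A. l \<in> closure (?\<nu> ` A)}" and "k \<noteq> l"
  then obtain g where g: "k g \<noteq> l g" by blast
  define \<delta> where "\<delta> = \<bar>l g - k g\<bar> / 2"
  have \<delta>: "\<delta> > 0" using g by (simp add: \<delta>_def)
  have c: "continuous_map euclidean euclideanreal (\<lambda>s. \<bar>s g - k g\<bar>)"
    by (intro continuous_map_real_abs continuous_map_diff continuous_map_eval) simp
  define U where "U = {s. \<bar>s g - k g\<bar> \<in> {..<\<delta>}}"
  have "open U"
    using openin_continuous_map_preimage[OF c, of "{..<\<delta>}"] by (simp add: U_def open_openin[symmetric])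
  have "k \<in> U \<inter> closure (range ?\<nu>)" using k \<delta> by (simp add: U_def right_hull_def)
  then have "k \<in> closure (U \<inter> range ?\<nu>)"
    using open_Int_closure_subset[OF \<open>open U\<close>] by blast
  \<comment> \<open>The witness for \<open>A\<close> is the set of all \<open>x\<close> whose
    translate lies in \<open>U\<close>. It is adherent to \<open>k\<close>, whereas \<open>l\<close>
    differs from \<open>k\<close> by \<open>2 * \<delta>\<close> at \<open>g\<close>.\<close>
  also have "U \<inter> range ?\<nu> = ?\<nu> ` {x. ?\<nu> x \<in> U}" by blast
  finally have "l \<in> closure (?\<nu> ` {x. ?\<nu> x \<in> U})" using eq by blast
  then have "\<bar>l g - k g\<bar> \<le> \<delta>"
    by (rule closure_fun_le[OF c, rotated]) (auto simp: U_def)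
  then show False using \<delta> by (simp add: \<delta>_def)
qed

text \<open>Basic neighbourhoods are given by finitely many coordinates and one common tolerance,
  the shape that the entourages of \<open>pointwise_uniformity\<close> have too.\<close>

lemma open_fun_iff:
  fixes W :: "('i \<Rightarrow> real) set"
  shows "open W \<longleftrightarrow> (\<forall>k\<in>W. \<exists>A \<epsilon>. finite A \<and> \<epsilon> > 0 \<and> (\<forall>l. (\<forall>i\<in>A. \<bar>k i - l i\<bar> < \<epsilon>) \<longrightarrow> l \<in> W))"
proof (intro iffI ballI)
  fix k assume W: "open W" and k: "k \<in> W"
  from W have "openin (product_topology (\<lambda>_. euclideanreal) UNIV) W"
    unfolding euclidean_product_topology by simp
  from product_topology_open_contains_basis[OF this k] obtain X
    where X: "k \<in> (\<Pi>\<^sub>E i\<in>UNIV. X i)" "\<forall>i. open (X i)" "finite {i. X i \<noteq> UNIV}"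
      "(\<Pi>\<^sub>E i\<in>UNIV. X i) \<subseteq> W"
    by auto
  let ?A = "{i. X i \<noteq> UNIV}"
  have "\<exists>e>0. \<forall>y. \<bar>k i - y\<bar> < e \<longrightarrow> y \<in> X i" for i
  proof -
    have "k i \<in> X i" using X(1) by (simp add: PiE_iff)
    then obtain e where "e > 0" "ball (k i) e \<subseteq> X i" using X(2) open_contains_ball by blast
    then show ?thesis by (intro exI[of _ e]) (auto simp: subset_iff dist_real_def)
  qed
  then obtain e where e: "\<And>i. e i > 0" "\<And>i y. \<bar>k i - y\<bar> < e i \<Longrightarrow> y \<in> X i" by metis
  \<comment> \<open>The element \<open>1\<close> keeps the set nonempty when no coordinate is
    constrained.\<close>
  define \<epsilon> where "\<epsilon> = Min (insert 1 (e ` ?A))"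
  have "\<epsilon> > 0" using X(3) e(1) by (simp add: \<epsilon>_def)
  moreover have "\<epsilon> \<le> e i" if "i \<in> ?A" for i using X(3) that by (simp add: \<epsilon>_def)
  then have "l \<in> W" if "\<forall>i\<in>?A. \<bar>k i - l i\<bar> < \<epsilon>" for l
    using that e(2) X(4) by (fastforce simp: PiE_iff)
  ultimately show "\<exists>A \<epsilon>. finite A \<and> \<epsilon> > 0 \<and> (\<forall>l. (\<forall>i\<in>A. \<bar>k i - l i\<bar> < \<epsilon>) \<longrightarrow> l \<in> W)"
    using X(3) by blast
next
  assume W: "\<forall>k\<in>W. \<exists>A \<epsilon>. finite A \<and> \<epsilon> > 0 \<and> (\<forall>l. (\<forall>i\<in>A. \<bar>k i - l i\<bar> < \<epsilon>) \<longrightarrow> l \<in> W)"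
  show "open W"
  proof (subst open_subopen, intro ballI)
    fix k assume "k \<in> W"
    with W obtain A \<epsilon> where A: "finite A" "\<epsilon> > 0" "\<And>l. \<forall>i\<in>A. \<bar>k i - l i\<bar> < \<epsilon> \<Longrightarrow> l \<in> W" by blast
    have "open {l. \<bar>k i - l i\<bar> \<in> {..<\<epsilon>}}" for i
    proof -
      have "continuous_map euclidean euclideanreal (\<lambda>l. \<bar>k i - l i\<bar>)"
        by (intro continuous_map_real_abs continuous_map_diff continuous_map_eval) simp
      from openin_continuous_map_preimage[OF this, of "{..<\<epsilon>}"] show ?thesis
        by (simp add: open_openin[symmetric])
    qed
    then have "open (\<Inter>i\<in>A. {l. \<bar>k i - l i\<bar> \<in> {..<\<epsilon>}})" using A(1) by (intro open_INT) auto
    moreover have "k \<in> (\<Inter>i\<in>A. {l. \<bar>k i - l i\<bar> \<in> {..<\<epsilon>}})" using A(2) by simp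
    moreover have "(\<Inter>i\<in>A. {l. \<bar>k i - l i\<bar> \<in> {..<\<epsilon>}}) \<subseteq> W" using A(3) by auto
    ultimately show "\<exists>T. open T \<and> k \<in> T \<and> T \<subseteq> W" by blast
  qed
qed

section \<open>From a compact space to the intrinsic condition\<close>

text \<open>This is the Heine-Cantor theorem. Finitely many interiors of balls cover
  \<open>Y\<close>, and the intersection of their entourages works: for \<open>y\<close> in such an
  interior with centre \<open>x\<close>, both \<open>y\<close> and every point near it have values
  within \<open>\<epsilon> / 2\<close> of \<open>F x\<close>.\<close>

lemma compatible_uniformity_uniformly_continuous:
  fixes Y :: "'y topology"
  assumes Y: "compact_space Y" and \<mu>: "compatible_uniformity Y \<mu>"
    and F: "continuous_map Y euclideanreal F" and \<epsilon>: "\<epsilon> > 0"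
  shows "eventually (\<lambda>(x, y). \<bar>F x - F y\<bar> < \<epsilon>) \<mu>"
proof -
  have supp: "eventually (\<lambda>p. p \<in> topspace Y \<times> topspace Y) \<mu>"
    and refl: "\<And>E x. eventually E \<mu> \<Longrightarrow> x \<in> topspace Y \<Longrightarrow> E (x, x)"
    and half: "\<And>E. eventually E \<mu> \<Longrightarrow>
        \<exists>D. eventually D \<mu> \<and> (\<forall>x y z. D (x, y) \<longrightarrow> D (y, z) \<longrightarrow> E (x, z))"
    and openin: "\<And>U. openin Y U \<longleftrightarrow>
        U \<subseteq> topspace Y \<and> (\<forall>x\<in>U. eventually (\<lambda>(x', y). x' = x \<longrightarrow> y \<in> U) \<mu>)"
    using \<mu> unfolding compatible_uniformity_def by (elim conjE, blast)+
  \<comment> \<open>\<open>I D x\<close> is the interior of the ball of all \<open>y\<close> with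
    \<open>D (x, y)\<close>. Balls of an entourage need not be open, but the cover must be.\<close>
  define I where "I D x = {z \<in> topspace Y. eventually (\<lambda>(x', y). x' = z \<longrightarrow> D (x, y)) \<mu>}"
    for D and x :: 'y
  have I_self: "x \<in> I D x" if "eventually D \<mu>" "x \<in> topspace Y" for D x
    using that by (auto simp: I_def elim: eventually_mono)
  have I_sub: "D (x, z)" if "z \<in> I D x" for D x z
  proof -
    have "z \<in> topspace Y" and e: "eventually (\<lambda>(x', y). x' = z \<longrightarrow> D (x, y)) \<mu>"
      using that by (auto simp: I_def)
    from refl[OF e this(1)] show ?thesis by simp
  qed
  have I_open: "openin Y (I D x)" for D x
    unfolding openin
  proof (intro conjI ballI)
    show "I D x \<subseteq> topspace Y" by (auto simp: I_def)
    fix z assume "z \<in> I D x"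
    then have "eventually (\<lambda>(x', y). x' = z \<longrightarrow> D (x, y)) \<mu>" by (simp add: I_def)
    from half[OF this] obtain E where E: "eventually E \<mu>"
      and EE: "\<And>a b c. E (a, b) \<Longrightarrow> E (b, c) \<Longrightarrow> a = z \<Longrightarrow> D (x, c)" by auto
    from E supp show "eventually (\<lambda>(x', y). x' = z \<longrightarrow> y \<in> I D x) \<mu>"
    proof eventually_elim
      case (elim p)
      have "snd p \<in> I D x" if "fst p = z"
      proof -
        have "eventually (\<lambda>(x', y). x' = snd p \<longrightarrow> D (x, y)) \<mu>"
          using E by eventually_elim (use elim EE that in \<open>auto split: prod.splits\<close>)
        then show ?thesis using elim by (auto simp: I_def)
      qed
      then show ?case by (auto split: prod.splits)
    qed
  qed
  define U where "U x = {y \<in> topspace Y. \<bar>F y - F x\<bar> < \<epsilon> / 2}" for x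
  \<comment> \<open>The entourage is halved so that two steps from \<open>x\<close> remain in
    \<open>U x\<close>: one step leads to a point of the cover, the other to its neighbour.\<close>
  have "\<exists>D. eventually D \<mu> \<and> (\<forall>y z. D (x, y) \<longrightarrow> D (y, z) \<longrightarrow> z \<in> U x)" if x: "x \<in> topspace Y" for x
  proof -
    have "continuous_map Y euclideanreal (\<lambda>y. \<bar>F y - F x\<bar>)"
      by (intro continuous_map_real_abs continuous_map_diff F) simp
    then have "openin Y {y \<in> topspace Y. \<bar>F y - F x\<bar> \<in> {..<\<epsilon> / 2}}"
      by (rule openin_continuous_map_preimage) simp
    then have "openin Y (U x)" by (simp add: U_def)
    moreover have "x \<in> U x" using x \<epsilon> by (simp add: U_def)
    ultimately have "eventually (\<lambda>(x', y). x' = x \<longrightarrow> y \<in> U x) \<mu>" unfolding openin by blast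
    from half[OF this] show ?thesis by auto
  qed
  then obtain D where D: "\<And>x. x \<in> topspace Y \<Longrightarrow> eventually (D x) \<mu>"
    and DD: "\<And>x y z. x \<in> topspace Y \<Longrightarrow> D x (x, y) \<Longrightarrow> D x (y, z) \<Longrightarrow> z \<in> U x" by metis
  define \<U> where "\<U> = (\<lambda>x. I (D x) x) ` topspace Y"
  have "\<And>V. V \<in> \<U> \<Longrightarrow> openin Y V" using I_open by (auto simp: \<U>_def)
  moreover have "topspace Y \<subseteq> \<Union> \<U>" using I_self[OF D] by (auto simp: \<U>_def)
  ultimately have "\<exists>\<F>. finite \<F> \<and> \<F> \<subseteq> \<U> \<and> topspace Y \<subseteq> \<Union> \<F>"
    by (rule compactinD[OF Y[unfolded compact_space_def]])
  then obtain A where A: "finite A" "A \<subseteq> topspace Y" "topspace Y \<subseteq> (\<Union>x\<in>A. I (D x) x)"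
    unfolding \<U>_def ex_finite_subset_image by blast
  have "eventually (\<lambda>p. \<forall>x\<in>A. D x p) \<mu>"
    using A(1,2) D by (intro eventually_ball_finite) auto
  with supp show ?thesis
  proof eventually_elim
    case (elim p)
    obtain y z where p: "p = (y, z)" by fastforce
    with elim have y: "y \<in> topspace Y" by auto
    then obtain x where x: "x \<in> A" "y \<in> I (D x) x" using A(3) by blast
    have "x \<in> topspace Y" using x(1) A(2) by blast
    have "D x (x, y)" by (rule I_sub[OF x(2)])
    moreover have "D x (y, y)" using refl[OF D] \<open>x \<in> topspace Y\<close> y by blast
    moreover have "D x (y, z)" using elim x(1) p by blast
    ultimately have "y \<in> U x" "z \<in> U x" using DD \<open>x \<in> topspace Y\<close> by blast+
    then have "\<bar>F y - F x\<bar> < \<epsilon> / 2" "\<bar>F z - F x\<bar> < \<epsilon> / 2" by (simp_all add: U_def)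
    then have "\<bar>F y - F z\<bar> < \<epsilon>" by linarith
    then show ?case by (simp add: p)
  qed
qed

text \<open>The pairs \<open>(u, y)\<close> where \<open>F\<close> changes by less than
  \<open>\<epsilon>\<close> form an open set containing \<open>{0} \<times> topspace Y\<close>. By
  the tube lemma it contains a product neighbourhood.\<close>

lemma compact_action_uniform_at_0:
  fixes act :: "'g::topological_group_add \<Rightarrow> 'y \<Rightarrow> 'y"
  assumes Y: "compact_space Y" "G_space Y act" and F: "continuous_map Y euclideanreal F"
    and \<epsilon>: "\<epsilon> > 0"
  shows "\<forall>\<^sub>F u in nhds 0. \<forall>y\<in>topspace Y. \<bar>F (act u y) - F y\<bar> < \<epsilon>"
proof -
  have act: "continuous_map (prod_topology euclidean Y) Y (\<lambda>(g, y). act g y)"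
    and act0: "\<And>y. y \<in> topspace Y \<Longrightarrow> act 0 y = y"
    using Y(2) unfolding G_space_def by blast+
  let ?d = "\<lambda>p. \<bar>F (act (fst p) (snd p)) - F (snd p)\<bar>"
  have "continuous_map (prod_topology euclidean Y) euclideanreal ?d"
    using continuous_map_compose[OF act F] continuous_map_compose[OF continuous_map_snd F]
    by (intro continuous_map_real_abs continuous_map_diff) (simp_all add: o_def case_prod_unfold)
  then have W: "openin (prod_topology euclidean Y)
      {p \<in> topspace (prod_topology euclidean Y). ?d p \<in> {..<\<epsilon>}}" (is "openin _ ?W")
    by (rule openin_continuous_map_preimage) simp
  have sub: "{0} \<times> topspace Y \<subseteq> ?W" using act0 \<epsilon> by auto
  have 0: "compactin euclidean {0::'g}" by simp
  obtain U V where U: "openin euclidean U" "{0} \<subseteq> U" and "openin Y V" "topspace Y \<subseteq> V"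
    and UV: "U \<times> V \<subseteq> ?W"
    by (rule Wallace_theorem_prod_topology[OF 0 Y(1)[unfolded compact_space_def] W sub])
  have "(u, y) \<in> ?W" if "u \<in> U" "y \<in> topspace Y" for u y
    using that UV \<open>topspace Y \<subseteq> V\<close> by blast
  then have "\<forall>u\<in>U. \<forall>y\<in>topspace Y. \<bar>F (act u y) - F y\<bar> < \<epsilon>" by simp
  moreover have "open U" "0 \<in> U" using U by (simp_all add: open_openin[symmetric])
  ultimately show ?thesis unfolding eventually_nhds by blast
qed

text \<open>The first clause follows from uniformity of the action at \<open>0\<close>. For the
  second, each \<open>k\<close> in the hull is the function \<open>F (act g y)\<close> of
  \<open>g\<close> for some point \<open>y\<close>; the SUC property at \<open>y\<close> and uniform
  continuity of \<open>F\<close> then apply.\<close>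

lemma SUC_factorization_imp_criterion:
  fixes f :: "'g::topological_group_add \<Rightarrow>\<^sub>C real"
  assumes "SUC_factorization Y act \<nu> F f"
  shows "SUC_criterion f"
proof -
  have suc: "compact_SUC_space Y act" and \<nu>: "continuous_map euclidean Y \<nu>"
    and equiv: "\<And>g x. \<nu> (g + x) = act g (\<nu> x)" and F: "continuous_map Y euclideanreal F"
    and f: "\<And>x. apply_bcontfun f x = F (\<nu> x)"
    using assms by (simp_all add: SUC_factorization_def)
  obtain \<mu> where Y: "compact_space Y" "G_space Y act" and \<mu>: "compatible_uniformity Y \<mu>"
    and small: "\<And>y E. y \<in> topspace Y \<Longrightarrow> eventually E \<mu> \<Longrightarrow>
        \<forall>\<^sub>F u in nhds 0. \<forall>g. E (act (g + u) y, act g y)"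
    using suc unfolding compact_SUC_space_def by blast
  have \<nu>_in: "\<nu> x \<in> topspace Y" for x
    using continuous_map_image_subset_topspace[OF \<nu>] by auto
  have "\<forall>\<^sub>F u in nhds 0. \<forall>x. \<bar>apply_bcontfun f (u + x) - apply_bcontfun f x\<bar> < \<epsilon>"
    if "\<epsilon> > 0" for \<epsilon>
    using compact_action_uniform_at_0[OF Y F that] \<nu>_in
    by (auto simp: f equiv elim: eventually_mono)
  moreover have "\<forall>\<^sub>F u in nhds 0. \<forall>g. \<bar>k (g + u) - k g\<bar> < \<epsilon>"
    if k: "k \<in> right_hull f" and \<epsilon>: "\<epsilon> > 0" for k \<epsilon>
  proof -
    \<comment> \<open>By equivariance, \<open>?\<Phi> (\<nu> x)\<close> is the translate of
      \<open>f\<close> by \<open>x\<close>. Hence the compact image of \<open>?\<Phi>\<close>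
      contains the whole hull.\<close>
    let ?\<Phi> = "\<lambda>y g. F (act g y)"
    have act: "continuous_map (prod_topology euclidean Y) Y (\<lambda>(g, y). act g y)"
      using Y(2) unfolding G_space_def by blast
    have "continuous_map Y Y (\<lambda>y. act g y)" for g
      using continuous_map_compose[OF _ act, of Y "\<lambda>y. (g, y)"]
      by (simp add: o_def continuous_map_pairedI)
    from continuous_map_compose[OF this F] have "continuous_map Y euclidean ?\<Phi>"
      by (intro continuous_map_fun_euclidean) (simp add: o_def)
    moreover have "range (\<lambda>x g. apply_bcontfun f (g + x)) \<subseteq> ?\<Phi> ` topspace Y"
      using \<nu>_in by (auto simp: f equiv)
    ultimately have "right_hull f \<subseteq> ?\<Phi> ` topspace Y"
      unfolding right_hull_def using continuous_map_image_compact_closure Y(1)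
      unfolding compact_space_def by blast
    with k obtain y where y: "y \<in> topspace Y" and k_eq: "k = ?\<Phi> y" by blast
    show ?thesis
      using small[OF y compatible_uniformity_uniformly_continuous[OF Y(1) \<mu> F \<epsilon>]]
      by (simp add: k_eq)
  qed
  ultimately show ?thesis unfolding SUC_criterion_def by blast
qed

section \<open>From the intrinsic condition to a compact space\<close>

text \<open>This is the initial uniformity on \<open>S\<close> for the coordinate functions
  \<open>\<lambda>s. e s i\<close>, written as a filter to fit
  \<open>compatible_uniformity\<close>.\<close>

definition pointwise_uniformity :: "'z set \<Rightarrow> ('z \<Rightarrow> 'i \<Rightarrow> real) \<Rightarrow> ('z \<times> 'z) filter" where
  "pointwise_uniformity S e = Abs_filter (\<lambda>E. \<exists>A \<epsilon>. finite A \<and> \<epsilon> > 0 \<and>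
     (\<forall>s\<in>S. \<forall>t\<in>S. (\<forall>i\<in>A. \<bar>e s i - e t i\<bar> < \<epsilon>) \<longrightarrow> E (s, t)))"

lemma eventually_pointwise_uniformity:
  "eventually E (pointwise_uniformity S e) \<longleftrightarrow> (\<exists>A \<epsilon>. finite A \<and> \<epsilon> > 0 \<and>
     (\<forall>s\<in>S. \<forall>t\<in>S. (\<forall>i\<in>A. \<bar>e s i - e t i\<bar> < \<epsilon>) \<longrightarrow> E (s, t)))"
  unfolding pointwise_uniformity_def
proof (subst eventually_Abs_filter)
  let ?near = "\<lambda>A \<epsilon> s t. \<forall>i\<in>A. \<bar>e s i - e t i\<bar> < \<epsilon>"
  let ?P = "\<lambda>E. \<exists>A \<epsilon>. finite A \<and> \<epsilon> > (0::real) \<and>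
     (\<forall>s\<in>S. \<forall>t\<in>S. ?near A \<epsilon> s t \<longrightarrow> E (s, t))"
  show "is_filter ?P"
  proof
    show "?P (\<lambda>_. True)" by (rule exI[of _ "{}"], rule exI[of _ 1]) simp
    show "?P (\<lambda>x. D x \<and> E x)" if D: "?P D" and E: "?P E" for D E
    proof -
      from D obtain A \<epsilon> where A: "finite A" "\<epsilon> > 0"
        "\<And>s t. s \<in> S \<Longrightarrow> t \<in> S \<Longrightarrow> ?near A \<epsilon> s t \<Longrightarrow> D (s, t)" by blast
      from E obtain B \<delta> where B: "finite B" "\<delta> > 0"
        "\<And>s t. s \<in> S \<Longrightarrow> t \<in> S \<Longrightarrow> ?near B \<delta> s t \<Longrightarrow> E (s, t)" by blast
      show ?thesis
      proof (intro exI conjI ballI impI)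
        show "finite (A \<union> B)" "min \<epsilon> \<delta> > 0" using A(1,2) B(1,2) by simp_all
        fix s t assume "s \<in> S" "t \<in> S" "?near (A \<union> B) (min \<epsilon> \<delta>) s t"
        then show "D (s, t)" "E (s, t)" by (simp_all add: A(3) B(3))
      qed
    qed
    show "?P E" if "\<forall>x. D x \<longrightarrow> E x" "?P D" for D E using that by blast
  qed
qed (rule refl)

lemma openin_pullback_iff:
  fixes e :: "'z \<Rightarrow> 'i \<Rightarrow> real"
  shows "openin (pullback_topology S e euclidean) U \<longleftrightarrow> U \<subseteq> S \<and>
    (\<forall>s\<in>U. \<exists>A \<epsilon>. finite A \<and> \<epsilon> > 0 \<and> (\<forall>t\<in>S. (\<forall>i\<in>A. \<bar>e s i - e t i\<bar> < \<epsilon>) \<longrightarrow> t \<in> U))"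
    (is "_ \<longleftrightarrow> ?rhs")
proof
  assume "openin (pullback_topology S e euclidean) U"
  then obtain W where W: "open W" and U: "U = e -` W \<inter> S"
    unfolding openin_pullback_topology by (auto simp: open_openin[symmetric])
  show ?rhs
  proof (intro conjI ballI)
    show "U \<subseteq> S" by (simp add: U)
    fix s assume "s \<in> U"
    then have "e s \<in> W" by (simp add: U)
    then obtain A \<epsilon> where "finite A" "\<epsilon> > 0" "\<forall>l. (\<forall>i\<in>A. \<bar>e s i - l i\<bar> < \<epsilon>) \<longrightarrow> l \<in> W"
      using W unfolding open_fun_iff by blast
    then show "\<exists>A \<epsilon>. finite A \<and> \<epsilon> > 0 \<and> (\<forall>t\<in>S. (\<forall>i\<in>A. \<bar>e s i - e t i\<bar> < \<epsilon>) \<longrightarrow> t \<in> U)"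
      unfolding U by blast
  qed
next
  assume rhs: ?rhs
  \<comment> \<open>This is the largest open set whose preimage in \<open>S\<close> lies in
    \<open>U\<close>.\<close>
  define W where "W = interior {k. \<forall>t\<in>S. e t = k \<longrightarrow> t \<in> U}"
  have "U = e -` W \<inter> S"
  proof
    show "e -` W \<inter> S \<subseteq> U" using interior_subset by (force simp: W_def)
    show "U \<subseteq> e -` W \<inter> S"
    proof
      fix s assume s: "s \<in> U"
      then obtain A \<epsilon> where A: "finite A" "\<epsilon> > 0"
        and near: "\<And>t. t \<in> S \<Longrightarrow> \<forall>i\<in>A. \<bar>e s i - e t i\<bar> < \<epsilon> \<Longrightarrow> t \<in> U"
        using rhs by blast
      let ?N = "{k. \<forall>i\<in>A. \<bar>e s i - k i\<bar> < \<epsilon>}"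
      have "open ?N"
        unfolding open_fun_iff
      proof
        fix k assume "k \<in> ?N"
        then have k: "\<And>i. i \<in> A \<Longrightarrow> \<bar>e s i - k i\<bar> < \<epsilon>" by blast
        \<comment> \<open>The minimal slack over the coordinates in \<open>A\<close> keeps a whole
          basic neighbourhood of \<open>k\<close> inside \<open>?N\<close>; the \<open>1\<close>
          covers an empty \<open>A\<close>.\<close>
        define \<delta> where "\<delta> = Min (insert 1 ((\<lambda>i. \<epsilon> - \<bar>e s i - k i\<bar>) ` A))"
        have "\<delta> > 0" using k A(1) by (simp add: \<delta>_def)
        moreover have "\<delta> \<le> \<epsilon> - \<bar>e s i - k i\<bar>" if "i \<in> A" for i
          using that A(1) by (simp add: \<delta>_def)
        then have "l \<in> ?N" if "\<forall>i\<in>A. \<bar>k i - l i\<bar> < \<delta>" for l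
          using that by (auto, smt (verit))
        ultimately show "\<exists>A \<delta>. finite A \<and> \<delta> > 0 \<and> (\<forall>l. (\<forall>i\<in>A. \<bar>k i - l i\<bar> < \<delta>) \<longrightarrow> l \<in> ?N)"
          using A(1) by blast
      qed
      moreover have "?N \<subseteq> {k. \<forall>t\<in>S. e t = k \<longrightarrow> t \<in> U}" using near by blast
      ultimately have "e s \<in> W" using A(2) by (auto simp: W_def intro!: interiorI)
      then show "s \<in> e -` W \<inter> S" using s rhs by blast
    qed
  qed
  then show "openin (pullback_topology S e euclidean) U"
    unfolding openin_pullback_topology by (intro exI[of _ W]) (simp add: W_def open_openin[symmetric])
qed

lemma compatible_pointwise_uniformity:
  "compatible_uniformity (pullback_topology S e euclidean) (pointwise_uniformity S e)"
proof -
  have ts: "topspace (pullback_topology S e euclidean) = S" by (simp add: topspace_pullback_topology)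
  let ?near = "\<lambda>A \<epsilon> s t. \<forall>i\<in>A. \<bar>e s i - e t i\<bar> < \<epsilon>"
  show ?thesis
    unfolding compatible_uniformity_def ts eventually_pointwise_uniformity
  proof (intro conjI allI impI)
    show "\<exists>A \<epsilon>. finite A \<and> \<epsilon> > (0::real) \<and> (\<forall>s\<in>S. \<forall>t\<in>S. ?near A \<epsilon> s t \<longrightarrow> (s, t) \<in> S \<times> S)"
      by (rule exI[of _ "{}"], rule exI[of _ 1]) simp
  next
    fix E assume "\<exists>A \<epsilon>. finite A \<and> \<epsilon> > (0::real) \<and> (\<forall>s\<in>S. \<forall>t\<in>S. ?near A \<epsilon> s t \<longrightarrow> E (s, t))"
    then obtain A \<epsilon> where A: "finite A" "\<epsilon> > 0"
        "\<And>s t. s \<in> S \<Longrightarrow> t \<in> S \<Longrightarrow> ?near A \<epsilon> s t \<Longrightarrow> E (s, t)" by blast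
    show "\<forall>x\<in>S. E (x, x)" using A(2,3) by simp
    show "\<exists>A \<epsilon>. finite A \<and> \<epsilon> > (0::real) \<and>
        (\<forall>s\<in>S. \<forall>t\<in>S. ?near A \<epsilon> s t \<longrightarrow> (case (s, t) of (x, y) \<Rightarrow> E (y, x)))"
    proof (intro exI conjI ballI impI)
      fix s t assume "s \<in> S" "t \<in> S" "?near A \<epsilon> s t"
      then show "case (s, t) of (x, y) \<Rightarrow> E (y, x)" by (simp add: A(3) abs_minus_commute)
    qed (fact A(1,2))+
    show "\<exists>D. (\<exists>A \<epsilon>. finite A \<and> \<epsilon> > (0::real) \<and> (\<forall>s\<in>S. \<forall>t\<in>S. ?near A \<epsilon> s t \<longrightarrow> D (s, t))) \<and>
        (\<forall>x y z. D (x, y) \<longrightarrow> D (y, z) \<longrightarrow> E (x, z))"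
    proof (intro exI conjI allI impI)
      let ?D = "\<lambda>(s, t). s \<in> S \<and> t \<in> S \<and> ?near A (\<epsilon> / 2) s t"
      show "finite A" "\<epsilon> / 2 > 0" using A by simp_all
      show "\<forall>s\<in>S. \<forall>t\<in>S. ?near A (\<epsilon> / 2) s t \<longrightarrow> ?D (s, t)" by simp
      fix x y z assume xy: "?D (x, y)" and yz: "?D (y, z)"
      have "\<bar>e x i - e z i\<bar> < \<epsilon>" if "i \<in> A" for i
      proof -
        have "\<bar>e x i - e y i\<bar> < \<epsilon> / 2" "\<bar>e y i - e z i\<bar> < \<epsilon> / 2" using xy yz that by auto
        then show ?thesis by linarith
      qed
      then show "E (x, z)" using A(3)[of x z] xy yz by simp
    qed
  next
    fix U
    show "openin (pullback_topology S e euclidean) U \<longleftrightarrow> U \<subseteq> S \<and> (\<forall>x\<in>U. \<exists>A \<epsilon>. finite A \<and> \<epsilon> > (0::real) \<and>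
        (\<forall>s\<in>S. \<forall>t\<in>S. ?near A \<epsilon> s t \<longrightarrow> (case (s, t) of (x', y) \<Rightarrow> x' = x \<longrightarrow> y \<in> U)))"
    proof -
      have "(\<forall>s\<in>S. \<forall>t\<in>S. ?near A \<epsilon> s t \<longrightarrow> (case (s, t) of (x', y) \<Rightarrow> x' = x \<longrightarrow> y \<in> U)) \<longleftrightarrow>
            (\<forall>t\<in>S. ?near A \<epsilon> x t \<longrightarrow> t \<in> U)" if "x \<in> S" for x A and \<epsilon> :: real
        using that unfolding prod.case by blast
      then show ?thesis unfolding openin_pullback_iff by (simp add: subset_iff cong: conj_cong)
    qed
  qed
qed

section \<open>The hull as a compact SUC space\<close>

text \<open>The hull, transported along \<open>j\<close>, serves as \<open>Y\<close>, with right
  translation as the action, translates of \<open>f\<close> as \<open>\<nu>\<close> and evaluation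
  at \<open>0\<close> as \<open>F\<close>. The first clause of the criterion makes the action
  continuous, the second makes it SUC.\<close>

lemma SUC_criterion_imp_factorization:
  fixes f :: "'g::topological_group_add \<Rightarrow>\<^sub>C real" and j :: "('g \<Rightarrow> real) \<Rightarrow> 'z"
  assumes crit: "SUC_criterion f" and j: "inj_on j (right_hull f)"
  shows "\<exists>(Y :: 'z topology) act \<nu> F. SUC_factorization Y act \<nu> F f"
proof -
  let ?K = "right_hull f"
  define S where "S = j ` ?K"
  define e where "e = inv_into ?K j"
  have e_j: "e (j k) = k" if "k \<in> ?K" for k
    using that j by (simp add: e_def)
  have e_K: "e s \<in> ?K" and j_e: "j (e s) = s" if "s \<in> S" for s
    using that by (auto simp: S_def e_def inv_into_into f_inv_into_f)
  have j_S: "j k \<in> S" if "k \<in> ?K" for k using that by (simp add: S_def)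
  define Y where "Y = pullback_topology S e euclidean"
  have ts: "topspace Y = S" by (simp add: Y_def topspace_pullback_topology)
  have cont_e: "continuous_map Y euclidean e"
    unfolding Y_def using continuous_map_pullback[of euclidean euclidean id S e] by simp
  have into_Y: "continuous_map X Y (\<lambda>x. j (q x))"
    if "continuous_map X euclidean q" "\<And>x. x \<in> topspace X \<Longrightarrow> q x \<in> ?K" for X q
    unfolding Y_def
  proof (rule continuous_map_pullback')
    show "continuous_map X euclidean (e \<circ> (\<lambda>x. j (q x)))"
      using that(2) by (intro continuous_map_eq[OF that(1)]) (simp add: e_j)
    show "topspace X \<subseteq> (\<lambda>x. j (q x)) -` S" using that(2) j_S by auto
  qed
  have "homeomorphic_maps Y (top_of_set ?K) e j"
    unfolding homeomorphic_maps_def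
    using cont_e into_Y[of "top_of_set ?K" "\<lambda>k. k"] e_K j_e e_j
    by (auto simp: ts continuous_map_in_subtopology)
  then have homeo: "Y homeomorphic_space top_of_set ?K" unfolding homeomorphic_space_def by blast
  have compact: "compact_space Y"
    using homeomorphic_compact_space[OF homeo] compact_right_hull[of f] by (simp add: compact_space_subtopology)
  have Hausdorff: "Hausdorff_space Y"
    using homeomorphic_Hausdorff_space[OF homeo] Hausdorff_space_subtopology[OF Hausdorff_space_fun_euclidean]
    by blast
  define act where "act u s = j (\<lambda>g. e s (g + u))" for u s
  have e_act: "e (act u s) = (\<lambda>g. e s (g + u))" and act_S: "act u s \<in> S" if "s \<in> S" for u s
    using e_j[OF right_hull_invariant[OF e_K[OF that]]] j_S[OF right_hull_invariant[OF e_K[OF that]]]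
    by (simp_all add: act_def)
  \<comment> \<open>Joint continuity splits the error: moving the group element costs at most
    \<open>\<epsilon> / 2\<close> uniformly over the hull, and moving the point is harmless at the
    fixed argument \<open>g + u\<close>.\<close>
  have "continuous_map (prod_topology euclidean Y) euclidean (\<lambda>p g. e (snd p) (g + fst p))"
  proof (rule continuous_map_fun_euclidean)
    fix g
    have "continuous_map (prod_topology euclidean Y) Met_TC.mtopology (\<lambda>p. e (snd p) (g + fst p))"
      unfolding Met_TC.continuous_map_to_metric
    proof (intro ballI allI impI)
      fix p and \<epsilon> :: real assume p: "p \<in> topspace (prod_topology (euclidean :: 'g topology) Y)" and \<epsilon>: "\<epsilon> > 0"
      obtain u s where us: "p = (u, s)" by fastforce
      with p have s: "s \<in> S" by (simp add: ts)
      have "\<epsilon> / 2 > 0" using \<epsilon> by simp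
      from right_hull_uniform_at[OF crit this, where g = g and ?u0.0 = u] obtain U where U: "open U" "u \<in> U"
        "\<And>v k. v \<in> U \<Longrightarrow> k \<in> ?K \<Longrightarrow> \<bar>k (g + v) - k (g + u)\<bar> \<le> \<epsilon> / 2"
        unfolding eventually_nhds by blast
      define V where "V = {t \<in> topspace Y. \<bar>e t (g + u) - e s (g + u)\<bar> \<in> {..<\<epsilon> / 2}}"
      have "continuous_map Y euclideanreal (\<lambda>t. \<bar>e t (g + u) - e s (g + u)\<bar>)"
        using continuous_map_compose[OF cont_e continuous_map_eval, of "g + u"]
        by (intro continuous_map_real_abs continuous_map_diff) (simp_all add: o_def)
      then have "openin Y V" unfolding V_def by (rule openin_continuous_map_preimage) simp
      then have "openin (prod_topology euclidean Y) (U \<times> V)"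
        using U(1) by (simp add: openin_prod_Times_iff open_openin[symmetric])
      moreover have "p \<in> U \<times> V" using U(2) s \<epsilon> by (simp add: us V_def ts)
      moreover have "e (snd q) (g + fst q) \<in> Met_TC.mball (e (snd p) (g + fst p)) \<epsilon>" if "q \<in> U \<times> V" for q
      proof -
        have q: "fst q \<in> U" "snd q \<in> S" "\<bar>e (snd q) (g + u) - e s (g + u)\<bar> < \<epsilon> / 2"
          using that by (auto simp: V_def ts)
        have "\<bar>e (snd q) (g + fst q) - e (snd q) (g + u)\<bar> \<le> \<epsilon> / 2"
          by (rule U(3)[OF q(1) e_K[OF q(2)]])
        with q(3) have "\<bar>e s (g + u) - e (snd q) (g + fst q)\<bar> < \<epsilon>" by linarith
        then show ?thesis by (simp add: us dist_real_def)
      qed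
      ultimately show "\<exists>W. openin (prod_topology euclidean Y) W \<and> p \<in> W \<and>
          (\<forall>q\<in>W. e (snd q) (g + fst q) \<in> Met_TC.mball (e (snd p) (g + fst p)) \<epsilon>)"
        by blast
    qed
    then show "continuous_map (prod_topology euclidean Y) euclideanreal (\<lambda>p. e (snd p) (g + fst p))"
      by simp
  qed
  from into_Y[OF this] have cont_act: "continuous_map (prod_topology euclidean Y) Y (\<lambda>(u, s). act u s)"
    using right_hull_invariant[OF e_K] by (auto simp: act_def case_prod_unfold ts)
  have regular: "completely_regular_space Y"
    using compact_Hausdorff_or_regular_imp_normal_space[OF compact] normal_imp_completely_regular_space Hausdorff
    by blast
  have "G_space Y act"
    unfolding G_space_def ts
  proof (intro conjI allI ballI)
    show "act 0 s = s" if "s \<in> S" for s using j_e[OF that] by (simp add: act_def)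
    show "act (g + h) s = act g (act h s)" if "s \<in> S" for g h s
    proof -
      have "act g (act h s) = j (\<lambda>x. e (act h s) (x + g))" by (simp add: act_def)
      also have "\<dots> = act (g + h) s" unfolding e_act[OF that] by (simp add: act_def add.assoc)
      finally show ?thesis by simp
    qed
  qed (fact regular Hausdorff cont_act)+
  moreover have "\<forall>\<^sub>F u in nhds 0. \<forall>g. E (act (g + u) s, act g s)"
    if s: "s \<in> S" and E: "eventually E (pointwise_uniformity S e)" for s E
  proof -
    from E obtain A \<epsilon> where A: "finite A" "\<epsilon> > 0"
      "\<And>s t. s \<in> S \<Longrightarrow> t \<in> S \<Longrightarrow> \<forall>i\<in>A. \<bar>e s i - e t i\<bar> < \<epsilon> \<Longrightarrow> E (s, t)"
      unfolding eventually_pointwise_uniformity by blast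
    have "\<forall>\<^sub>F u in nhds 0. \<forall>g. \<bar>e s (g + u) - e s g\<bar> < \<epsilon>"
      using crit e_K[OF s] A(2) unfolding SUC_criterion_def by blast
    then show ?thesis
    proof eventually_elim
      case (elim u)
      show ?case
      proof
        fix g
        \<comment> \<open>Coordinate \<open>i\<close> of \<open>act g s\<close> is
          \<open>e s (i + g)\<close>. Uniformity of the criterion in the group variable thus covers
          all \<open>g\<close> and all coordinates at once.\<close>
        have "\<bar>e s (i + g + u) - e s (i + g)\<bar> < \<epsilon>" for i using elim by blast
        then show "E (act (g + u) s, act g s)"
          by (intro A(3) act_S s) (simp add: e_act s add.assoc)
      qed
    qed
  qed
  ultimately have suc: "compact_SUC_space Y act"
    unfolding compact_SUC_space_def ts
    using compact compatible_pointwise_uniformity[of S e, folded Y_def] by blast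
  let ?\<nu> = "\<lambda>x g. apply_bcontfun f (g + x)"
  define \<nu> where "\<nu> x = j (?\<nu> x)" for x
  have \<nu>_S: "\<nu> x \<in> S" and e_\<nu>: "e (\<nu> x) = ?\<nu> x" for x
    using j_S[OF translate_in_right_hull] e_j[OF translate_in_right_hull] by (simp_all add: \<nu>_def)
  have "continuous_map euclidean Y \<nu>"
    unfolding \<nu>_def
  proof (rule into_Y)
    show "continuous_map euclidean euclidean ?\<nu>"
    proof (rule continuous_map_fun_euclidean)
      fix g
      have "continuous_on UNIV (\<lambda>x. apply_bcontfun f (g + x))"
        by (intro continuous_on_compose2[OF continuous_on_apply_bcontfun[of UNIV f]] continuous_intros) auto
      then show "continuous_map euclidean euclideanreal (\<lambda>x. apply_bcontfun f (g + x))" by simp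
    qed
  qed (rule translate_in_right_hull)
  moreover have "\<nu> (g + x) = act g (\<nu> x)" for g x
    by (simp add: act_def e_\<nu>) (simp add: \<nu>_def add.assoc)
  moreover have "Y closure_of range \<nu> = topspace Y"
  proof
    show "topspace Y \<subseteq> Y closure_of range \<nu>"
    proof
      fix s assume s: "s \<in> topspace Y"
      have "\<exists>x. \<nu> x \<in> T" if sT: "s \<in> T" and T_open: "openin Y T" for T
      proof -
        obtain W where "open W" and T: "T = e -` W \<inter> S"
          using T_open unfolding Y_def openin_pullback_topology by (auto simp: open_openin[symmetric])
        have "e s \<in> W \<inter> closure (range ?\<nu>)"
          using sT e_K[of s] s by (simp add: T right_hull_def ts)
        then have "W \<inter> range ?\<nu> \<noteq> {}"
          using open_Int_closure_eq_empty[OF \<open>open W\<close>] by blast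
        then obtain x where "?\<nu> x \<in> W" by blast
        then have "\<nu> x \<in> T" using \<nu>_S by (simp add: T e_\<nu>)
        then show ?thesis ..
      qed
      then show "s \<in> Y closure_of range \<nu>" using s by (auto simp: in_closure_of)
    qed
  qed (rule closure_of_subset_topspace)
  moreover have "continuous_map Y euclideanreal (\<lambda>s. e s 0)"
    using continuous_map_compose[OF cont_e continuous_map_eval, of 0] by (simp add: o_def)
  moreover have "apply_bcontfun f = (\<lambda>s. e s 0) \<circ> \<nu>" by (simp add: fun_eq_iff e_\<nu>)
  ultimately have "SUC_factorization Y act \<nu> (\<lambda>s. e s 0) f"
    unfolding SUC_factorization_def using suc by blast
  then show ?thesis by blast
qed

lemma SUC_criterion_imp_SUC: "SUC_criterion f \<Longrightarrow> f \<in> SUC"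
  unfolding SUC_def using SUC_criterion_imp_factorization[OF _ inj_on_adherent_sets] by blast

section \<open>From a representation to the intrinsic condition\<close>

lemma continuous_map_euclidean_metric:
  assumes "Metric_space M d" "continuous_map euclidean (Metric_space.mtopology M d) f" "\<epsilon> > 0"
  shows "\<forall>\<^sub>F u in nhds x. f u \<in> M \<and> d (f x) (f u) < \<epsilon>"
proof -
  interpret Metric_space M d by fact
  obtain U where "open U" "x \<in> U" "\<forall>y\<in>U. f y \<in> mball (f x) \<epsilon>"
    using assms(2)[unfolded continuous_map_to_metric, rule_format, of x \<epsilon>] assms(3)
    by (auto simp: open_openin[symmetric])
  then show ?thesis unfolding eventually_nhds by auto
qed

lemma continuous_map_euclidean_metricI:
  fixes f :: "'a::topological_space \<Rightarrow> 'b"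
  assumes "Metric_space M d" "\<And>x. f x \<in> M"
    and "\<And>x \<epsilon>. \<epsilon> > 0 \<Longrightarrow> \<forall>\<^sub>F u in nhds x. d (f x) (f u) < \<epsilon>"
  shows "continuous_map euclidean (Metric_space.mtopology M d) f"
proof -
  interpret Metric_space M d by fact
  show ?thesis unfolding continuous_map_to_metric
  proof (intro ballI allI impI)
    fix x :: 'a and \<epsilon> :: real assume "\<epsilon> > 0"
    then obtain U where "open U" "x \<in> U" "\<forall>u\<in>U. d (f x) (f u) < \<epsilon>"
      using assms(3)[of \<epsilon> x] unfolding eventually_nhds by blast
    then show "\<exists>U. openin euclidean U \<and> x \<in> U \<and> (\<forall>y\<in>U. f y \<in> mball (f x) \<epsilon>)"
      using assms(2) by (auto simp: in_mball open_openin[symmetric])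
  qed
qed

lemma norm_on_triangle:
  assumes "subspace V" "\<And>x y. x \<in> V \<Longrightarrow> y \<in> V \<Longrightarrow> N (x + y) \<le> N x + N y"
    and "x \<in> V" "y \<in> V" "z \<in> V"
  shows "N (x - z) \<le> N (x - y) + N (y - z)"
  using assms(2)[OF subspace_diff[OF assms(1,3,4)] subspace_diff[OF assms(1,4,5)]] by simp

text \<open>The norm axioms are assumed apart from completeness, because the metric has to be
  available before completeness of the Hoelder space can be proved.\<close>

lemma Metric_space_norm_dist:
  assumes V: "subspace V"
    and nonneg: "\<And>x. x \<in> V \<Longrightarrow> 0 \<le> N x"
    and zero: "\<And>x. x \<in> V \<Longrightarrow> N x = 0 \<longleftrightarrow> x = 0"
    and scale: "\<And>c x. x \<in> V \<Longrightarrow> N (c *\<^sub>R x) = \<bar>c\<bar> * N x"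
    and add: "\<And>x y. x \<in> V \<Longrightarrow> y \<in> V \<Longrightarrow> N (x + y) \<le> N x + N y"
  shows "Metric_space V (norm_dist V N)"
proof
  show "0 \<le> norm_dist V N x y" for x y
    using V nonneg by (simp add: norm_dist_def dist_on_def subspace_diff)
  show "norm_dist V N x y = norm_dist V N y x" for x y
    using scale[of "x - y" "-1"] V by (auto simp: norm_dist_def dist_on_def subspace_diff)
  show "norm_dist V N x y = 0 \<longleftrightarrow> x = y" if "x \<in> V" "y \<in> V" for x y
    using zero[of "x - y"] that V by (simp add: norm_dist_def dist_on_def subspace_diff)
  show "norm_dist V N x z \<le> norm_dist V N x y + norm_dist V N y z"
    if "x \<in> V" "y \<in> V" "z \<in> V" for x y z
    using norm_on_triangle[OF V add that] that by (simp add: norm_dist_def dist_on_def)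
qed

lemma banach_space_onD:
  assumes "banach_space_on V N"
  shows "subspace V" "x \<in> V \<Longrightarrow> 0 \<le> N x" "x \<in> V \<Longrightarrow> N x = 0 \<longleftrightarrow> x = 0"
    "x \<in> V \<Longrightarrow> N (c *\<^sub>R x) = \<bar>c\<bar> * N x" "x \<in> V \<Longrightarrow> y \<in> V \<Longrightarrow> N (x + y) \<le> N x + N y"
proof -
  have "subspace V" and nonneg: "\<forall>x\<in>V. 0 \<le> N x" and zero: "\<forall>x\<in>V. N x = 0 \<longleftrightarrow> x = 0"
    and scale: "\<forall>c. \<forall>x\<in>V. N (c *\<^sub>R x) = \<bar>c\<bar> * N x"
    and add: "\<forall>x\<in>V. \<forall>y\<in>V. N (x + y) \<le> N x + N y"
    using assms unfolding banach_space_on_def by - (elim conjE, assumption)+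
  show "subspace V" by fact
  show "x \<in> V \<Longrightarrow> 0 \<le> N x" "x \<in> V \<Longrightarrow> N x = 0 \<longleftrightarrow> x = 0"
    "x \<in> V \<Longrightarrow> N (c *\<^sub>R x) = \<bar>c\<bar> * N x" "x \<in> V \<Longrightarrow> y \<in> V \<Longrightarrow> N (x + y) \<le> N x + N y"
    by (fact nonneg[rule_format] zero[rule_format] scale[rule_format] add[rule_format])+
qed

lemma banach_metric:
  assumes "banach_space_on V N"
  shows "Metric_space V (norm_dist V N)"
  by (rule Metric_space_norm_dist; fact banach_space_onD[OF assms])

lemma norm_dist_eq: "x \<in> V \<Longrightarrow> y \<in> V \<Longrightarrow> norm_dist V N x y = N (x - y)"
  by (simp add: norm_dist_def dist_on_def)

section \<open>Functionals and the dual norm\<close>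

locale banach_on =
  fixes V :: "'v::real_vector set" and N :: "'v \<Rightarrow> real"
  assumes banach: "banach_space_on V N"
begin

lemmas subspace_V = banach_space_onD(1)[OF banach] and N_nonneg = banach_space_onD(2)[OF banach]
  and N_eq_0 = banach_space_onD(3)[OF banach] and N_scale = banach_space_onD(4)[OF banach]

text \<open>In contrast to \<open>dual\<close>, extensionality is not demanded: a pointwise
  difference of two extensional functionals is \<open>0\<close> outside \<open>V\<close> and need
  not be extensional.\<close>

definition functional :: "('v \<Rightarrow> real) \<Rightarrow> bool" where
  "functional \<phi> \<longleftrightarrow> linear_within V \<phi> \<and> (\<exists>B. \<forall>v\<in>V. \<bar>\<phi> v\<bar> \<le> B * N v)"

lemma functional_diff:
  assumes "functional \<phi>" "functional \<theta>"
  shows "functional (\<lambda>v. \<phi> v - \<theta> v)"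
proof -
  obtain A B where A: "\<forall>v\<in>V. \<bar>\<phi> v\<bar> \<le> A * N v" and B: "\<forall>v\<in>V. \<bar>\<theta> v\<bar> \<le> B * N v"
    using assms unfolding functional_def by blast
  have "\<bar>\<phi> v - \<theta> v\<bar> \<le> (A + B) * N v" if "v \<in> V" for v
  proof -
    have "\<bar>\<phi> v - \<theta> v\<bar> \<le> \<bar>\<phi> v\<bar> + \<bar>\<theta> v\<bar>" by linarith
    also have "\<dots> \<le> (A + B) * N v" using A B that by (simp add: distrib_right add_mono)
    finally show ?thesis .
  qed
  then show ?thesis
    using assms unfolding functional_def linear_within_def by (auto simp: right_diff_distrib)
qed

lemma dual_iff: "\<phi> \<in> dual V N \<longleftrightarrow> \<phi> \<in> extensional V \<and> functional \<phi>"
  by (auto simp: dual_def functional_def)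

lemma functional_zero: "functional \<phi> \<Longrightarrow> \<phi> 0 = 0"
  unfolding functional_def linear_within_def
  by (metis scaleR_zero_left subspace_V subspace_0)

lemma functional_minus:
  assumes "functional \<phi>" "x \<in> V" "y \<in> V"
  shows "\<phi> (x - y) = \<phi> x - \<phi> y"
proof -
  have "\<phi> ((x - y) + y) = \<phi> (x - y) + \<phi> y"
    using assms subspace_diff[OF subspace_V] unfolding functional_def linear_within_def by blast
  then show ?thesis by simp
qed

lemma dual_norm_le:
  assumes "B \<ge> 0" "\<And>v. v \<in> V \<Longrightarrow> \<bar>\<phi> v\<bar> \<le> B * N v"
  shows "dual_norm V N \<phi> \<le> B"
  unfolding dual_norm_def
proof (rule cSUP_least)
  show "{v \<in> V. N v \<le> 1} \<noteq> {}"
    using N_eq_0[of 0] subspace_0[OF subspace_V] by (auto intro!: exI[of _ 0])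
  show "\<bar>\<phi> v\<bar> \<le> B" if "v \<in> {v \<in> V. N v \<le> 1}" for v
    using assms(2)[of v] that assms(1) mult_left_le[of "N v" B] by force
qed

text \<open>A real \<open>SUP\<close> is informative only for bounded sets, so this must be known
  before \<open>dual_norm\<close> can be estimated from below.\<close>

lemma bdd_above_dual_norm:
  assumes "functional \<phi>"
  shows "bdd_above ((\<lambda>v. \<bar>\<phi> v\<bar>) ` {v \<in> V. N v \<le> 1})"
proof -
  obtain B where B: "\<forall>v\<in>V. \<bar>\<phi> v\<bar> \<le> B * N v" using assms unfolding functional_def by blast
  show ?thesis
  proof (rule bdd_aboveI2)
    fix w assume w: "w \<in> {v \<in> V. N v \<le> 1}"
    have "\<bar>\<phi> w\<bar> \<le> \<bar>B\<bar> * N w"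
      using B w N_nonneg[of w] by (smt (verit) mem_Collect_eq mult_right_mono)
    also have "\<dots> \<le> \<bar>B\<bar>" using w by (simp add: mult_left_le)
    finally show "\<bar>\<phi> w\<bar> \<le> \<bar>B\<bar>" .
  qed
qed

lemma le_dual_norm:
  assumes "functional \<phi>" "v \<in> V"
  shows "\<bar>\<phi> v\<bar> \<le> dual_norm V N \<phi> * N v"
proof (cases "v = 0")
  case True
  then show ?thesis using functional_zero[OF assms(1)] N_eq_0[of 0] assms(2) by simp
next
  case False
  then have pos: "N v > 0" using N_nonneg[OF assms(2)] N_eq_0[OF assms(2)] by linarith
  define w where "w = (1 / N v) *\<^sub>R v"
  have w: "w \<in> V" "N w = 1"
    using assms(2) subspace_V N_scale[OF assms(2)] pos by (auto simp: w_def subspace_scale)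
  have "\<bar>\<phi> w\<bar> \<le> dual_norm V N \<phi>"
    unfolding dual_norm_def using w by (intro cSUP_upper bdd_above_dual_norm assms) auto
  moreover have "\<phi> w = \<phi> v / N v"
    using assms unfolding functional_def linear_within_def w_def by simp
  ultimately show ?thesis using pos by (simp add: abs_divide pos_divide_le_eq)
qed

lemma dual_norm_nonneg:
  assumes "functional \<phi>"
  shows "0 \<le> dual_norm V N \<phi>"
proof -
  have "\<bar>\<phi> 0\<bar> \<le> dual_norm V N \<phi>"
    unfolding dual_norm_def using N_eq_0[of 0] subspace_0[OF subspace_V]
    by (intro cSUP_upper bdd_above_dual_norm assms) auto
  then show ?thesis by linarith
qed

lemma Metric_space_dual:
  "Metric_space (dual V N) (dist_on (dual V N) (\<lambda>\<phi> \<theta>. dual_norm V N (\<lambda>v. \<phi> v - \<theta> v)))"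
    (is "Metric_space ?D ?d")
proof
  show "0 \<le> ?d \<phi> \<theta>" for \<phi> \<theta>
    by (auto simp: dist_on_def dual_iff intro!: dual_norm_nonneg functional_diff)
  show "?d \<phi> \<theta> = ?d \<theta> \<phi>" for \<phi> \<theta>
    by (simp add: dist_on_def dual_norm_def abs_minus_commute)
  show "?d \<phi> \<theta> = 0 \<longleftrightarrow> \<phi> = \<theta>" if "\<phi> \<in> ?D" "\<theta> \<in> ?D" for \<phi> \<theta>
  proof
    assume "?d \<phi> \<theta> = 0"
    then have 0: "dual_norm V N (\<lambda>v. \<phi> v - \<theta> v) = 0" using that by (simp add: dist_on_def)
    have "\<phi> v = \<theta> v" if "v \<in> V" for v
      using le_dual_norm[OF functional_diff that, of \<phi> \<theta>] 0 \<open>\<phi> \<in> ?D\<close> \<open>\<theta> \<in> ?D\<close>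
      by (simp add: dual_iff)
    then show "\<phi> = \<theta>" using that by (auto simp: dual_iff intro: extensionalityI)
  next
    assume "\<phi> = \<theta>"
    then show "?d \<phi> \<theta> = 0"
      using dual_norm_le[of 0 "\<lambda>v. \<phi> v - \<theta> v"] dual_norm_nonneg[OF functional_diff, of \<phi> \<theta>] that
      by (auto simp: dist_on_def dual_iff)
  qed
  show "?d \<phi> \<rho> \<le> ?d \<phi> \<theta> + ?d \<theta> \<rho>" if "\<phi> \<in> ?D" "\<theta> \<in> ?D" "\<rho> \<in> ?D" for \<phi> \<theta> \<rho>
  proof -
    have f: "functional (\<lambda>v. \<phi> v - \<theta> v)" "functional (\<lambda>v. \<theta> v - \<rho> v)"
      using that by (auto simp: dual_iff intro: functional_diff)
    have "dual_norm V N (\<lambda>v. \<phi> v - \<rho> v)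
            \<le> dual_norm V N (\<lambda>v. \<phi> v - \<theta> v) + dual_norm V N (\<lambda>v. \<theta> v - \<rho> v)"
    proof (rule dual_norm_le)
      show "0 \<le> dual_norm V N (\<lambda>v. \<phi> v - \<theta> v) + dual_norm V N (\<lambda>v. \<theta> v - \<rho> v)"
        using f by (simp add: dual_norm_nonneg)
      show "\<bar>\<phi> v - \<rho> v\<bar> \<le> (dual_norm V N (\<lambda>v. \<phi> v - \<theta> v) + dual_norm V N (\<lambda>v. \<theta> v - \<rho> v)) * N v"
        if "v \<in> V" for v
        using le_dual_norm[OF f(1) that] le_dual_norm[OF f(2) that] by (simp add: distrib_right)
    qed
    then show ?thesis using that by (simp add: dist_on_def)
  qed
qed

text \<open>Linearity and a common bound \<open>B\<close> are closed conditions for pointwise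
  convergence. No limit in the full product therefore leaves the dual, which is the core of the
  Banach-Alaoglu theorem.\<close>

lemma closure_of_functionals_subset_dual:
  assumes "S \<subseteq> extensional V" "\<And>\<phi>. \<phi> \<in> S \<Longrightarrow> linear_within V \<phi>"
    and "\<And>\<phi> v. \<phi> \<in> S \<Longrightarrow> v \<in> V \<Longrightarrow> \<bar>\<phi> v\<bar> \<le> B * N v"
  shows "product_topology (\<lambda>_. euclideanreal) V closure_of S \<subseteq> dual V N"
proof
  let ?X = "product_topology (\<lambda>_. euclideanreal) V"
  fix \<phi> assume \<phi>: "\<phi> \<in> ?X closure_of S"
  have ext: "\<phi> \<in> extensional V"
    using subsetD[OF closure_of_subset_topspace \<phi>] by (simp add: PiE_def)
  have coord: "continuous_map ?X euclideanreal (\<lambda>\<phi>. \<phi> w)" if "w \<in> V" for w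
    using continuous_map_product_coordinates[OF that, of "\<lambda>_. euclideanreal"] .
  have bound: "\<bar>\<phi> w\<bar> \<le> B * N w" if "w \<in> V" for w
    using assms(3) that by (intro closure_of_le[OF continuous_map_real_abs[OF coord[OF that]] _ \<phi>])
  have add: "\<phi> (x + y) = \<phi> x + \<phi> y" if "x \<in> V" "y \<in> V" for x y
  proof -
    have "continuous_map ?X euclideanreal (\<lambda>\<phi>. \<bar>\<phi> (x + y) - (\<phi> x + \<phi> y)\<bar>)"
      using that subspace_add[OF subspace_V that]
      by (intro continuous_map_real_abs continuous_map_diff continuous_map_add coord)
    from closure_of_le[OF this _ \<phi>, of 0] show ?thesis
      using assms(2) that by (simp add: linear_within_def)
  qed
  have scale: "\<phi> (c *\<^sub>R x) = c *\<^sub>R \<phi> x" if "x \<in> V" for c x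
  proof -
    have "continuous_map ?X euclideanreal (\<lambda>\<phi>. \<bar>\<phi> (c *\<^sub>R x) - c * \<phi> x\<bar>)"
      using that subspace_scale[OF subspace_V that]
      by (intro continuous_map_real_abs continuous_map_diff continuous_map_real_mult_left coord)
    from closure_of_le[OF this _ \<phi>, of 0] show ?thesis
      using assms(2) that by (simp add: linear_within_def)
  qed
  show "\<phi> \<in> dual V N"
    using ext bound add scale unfolding dual_def linear_within_def by blast
qed

end

section \<open>Co-representations and orbit closures\<close>

locale banach_corep = banach_on V N for V :: "'v::real_vector set" and N +
  fixes h :: "'g::topological_group_add \<Rightarrow> 'v \<Rightarrow> 'v"
  assumes corep: "continuous_corep V N h"
begin

lemma h_in_V: "w \<in> V \<Longrightarrow> h g w \<in> V"
  and N_h: "w \<in> V \<Longrightarrow> N (h g w) = N w"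
  and linear_h: "linear_within V (h g)"
  using corep unfolding continuous_corep_def Iso_def by blast+

lemma h_add: "w \<in> V \<Longrightarrow> h (g1 + g2) w = h g2 (h g1 w)"
proof -
  assume "w \<in> V"
  have "\<forall>g1 g2. h (g1 + g2) = compose V (h g2) (h g1)"
    using corep unfolding continuous_corep_def by (elim conjE)
  then have "h (g1 + g2) = compose V (h g2) (h g1)" by blast
  with \<open>w \<in> V\<close> show ?thesis by (simp add: compose_eq)
qed

lemma h_minus: "x \<in> V \<Longrightarrow> y \<in> V \<Longrightarrow> h g (x - y) = h g x - h g y"
proof -
  assume xy: "x \<in> V" "y \<in> V"
  have "h g ((x - y) + y) = h g (x - y) + h g y"
    using linear_h[of g] subspace_diff[OF subspace_V xy] xy(2) unfolding linear_within_def by blast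
  then show ?thesis by simp
qed

lemma strong_continuity:
  assumes "w \<in> V" "\<epsilon> > 0"
  shows "\<forall>\<^sub>F u in nhds g. N (h g w - h u w) < \<epsilon>"
proof -
  have "continuous_map euclidean (product_topology (\<lambda>_. Metric_space.mtopology V (norm_dist V N)) V) h"
    using corep unfolding continuous_corep_def strong_operator_topology_def
    by (simp add: continuous_map_in_subtopology)
  from continuous_map_compose[OF this continuous_map_product_projection[OF assms(1)]]
  have "continuous_map euclidean (Metric_space.mtopology V (norm_dist V N)) (\<lambda>u. h u w)"
    by (simp add: o_def)
  from continuous_map_euclidean_metric[OF banach_metric[OF banach] this assms(2), of g]
  show ?thesis
    by eventually_elim (use assms(1) in \<open>simp add: norm_dist_eq h_in_V\<close>)
qed

text \<open>The operators are isometries, so a bound for \<open>\<psi>\<close> serves its entire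
  orbit.\<close>

lemma dual_action_functional:
  assumes "functional \<psi>"
  shows "linear_within V (dual_action V h g \<psi>)"
    and "(\<And>w. w \<in> V \<Longrightarrow> \<bar>\<psi> w\<bar> \<le> B * N w) \<Longrightarrow> w \<in> V \<Longrightarrow> \<bar>dual_action V h g \<psi> w\<bar> \<le> B * N w"
proof -
  have l: "linear_within V \<psi>" using assms by (simp add: functional_def)
  have c: "c *\<^sub>R x \<in> V" "x + y \<in> V" if "x \<in> V" "y \<in> V" for c x y
    using that subspace_V by (simp_all add: subspace_scale subspace_add)
  show "linear_within V (dual_action V h g \<psi>)"
    using l linear_h[of g] h_in_V c unfolding linear_within_def dual_action_def by simp
  show "\<bar>dual_action V h g \<psi> w\<bar> \<le> B * N w"
    if "\<And>w. w \<in> V \<Longrightarrow> \<bar>\<psi> w\<bar> \<le> B * N w" "w \<in> V"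
    using that(1)[OF h_in_V[OF that(2)], of g] that(2) by (simp add: dual_action_def N_h)
qed

lemma dual_action_in_dual:
  assumes "\<psi> \<in> dual V N"
  shows "dual_action V h g \<psi> \<in> dual V N"
proof -
  have f: "functional \<psi>" using assms by (simp add: dual_iff)
  then obtain B where B: "\<And>w. w \<in> V \<Longrightarrow> \<bar>\<psi> w\<bar> \<le> B * N w" unfolding functional_def by blast
  have "dual_action V h g \<psi> \<in> extensional V" by (simp add: dual_action_def)
  then show ?thesis
    using dual_action_functional(1)[OF f] dual_action_functional(2)[OF f B]
    unfolding dual_def by blast
qed

text \<open>The orbit is uniformly bounded, so its closure in the full product already lies in the
  dual and agrees with the weak-star closure. Compactness comes from the same bound.\<close>

lemma orbit_closure_eq:
  assumes "\<psi> \<in> dual V N"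
  shows "orbit_closure V N h \<psi>
           = product_topology (\<lambda>_. euclideanreal) V closure_of range (\<lambda>g. dual_action V h g \<psi>)"
    and "compactin (product_topology (\<lambda>_. euclideanreal) V) (orbit_closure V N h \<psi>)"
proof -
  let ?X = "product_topology (\<lambda>_. euclideanreal) V" and ?S = "range (\<lambda>g. dual_action V h g \<psi>)"
  have f: "functional \<psi>" using assms by (simp add: dual_iff)
  then obtain B where B: "\<And>w. w \<in> V \<Longrightarrow> \<bar>\<psi> w\<bar> \<le> B * N w" unfolding functional_def by blast
  have "?X closure_of ?S \<subseteq> dual V N"
    using dual_action_functional(1)[OF f] dual_action_functional(2)[OF f B]
    by (intro closure_of_functionals_subset_dual[of _ B]) (auto simp: dual_action_def)
  moreover have "dual V N \<inter> ?S = ?S" using dual_action_in_dual[OF assms] by blast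
  ultimately show eq: "orbit_closure V N h \<psi> = ?X closure_of ?S"
    unfolding orbit_closure_def weak_star_topology_def closure_of_subtopology by auto
  show "compactin ?X (orbit_closure V N h \<psi>)"
    unfolding eq using dual_action_functional(2)[OF f B]
    by (intro compactin_closure_of_bounded[of _ _ "\<lambda>w. B * N w"]) auto
qed

text \<open>Together with its converse below, this replaces the dual norm topology by an estimate
  that is uniform over all vectors \<open>w\<close> of a given norm.\<close>

lemma norm_G_continuousD:
  assumes "\<phi> \<in> dual V N" "norm_G_continuous V N h \<phi>" "\<epsilon> > 0"
  shows "\<forall>\<^sub>F u in nhds g. \<forall>w\<in>V. \<bar>\<phi> (h g w) - \<phi> (h u w)\<bar> \<le> \<epsilon> * N w"
  using continuous_map_euclidean_metric[OF Metric_space_dual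
      assms(2)[unfolded norm_G_continuous_def dual_norm_topology_def] assms(3), of g]
proof eventually_elim
  case (elim u)
  let ?d = "\<lambda>w. dual_action V h g \<phi> w - dual_action V h u \<phi> w"
  have "functional ?d"
    using dual_action_in_dual[OF assms(1)] by (intro functional_diff) (simp_all add: dual_iff)
  moreover have "dual_norm V N ?d < \<epsilon>"
    using elim dual_action_in_dual[OF assms(1)] by (simp add: dist_on_def)
  ultimately have "\<bar>?d w\<bar> \<le> \<epsilon> * N w" if "w \<in> V" for w
    using le_dual_norm[of ?d w] that N_nonneg[OF that]
    by (meson less_imp_le mult_right_mono order_trans)
  then show ?case by (simp add: dual_action_def)
qed

lemma norm_G_continuousI:
  assumes "\<phi> \<in> dual V N"
    and "\<And>g \<epsilon>. \<epsilon> > 0 \<Longrightarrow> \<forall>\<^sub>F u in nhds g. \<forall>w\<in>V. \<bar>\<phi> (h g w) - \<phi> (h u w)\<bar> \<le> \<epsilon> * N w"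
  shows "norm_G_continuous V N h \<phi>"
  unfolding norm_G_continuous_def dual_norm_topology_def
proof (rule continuous_map_euclidean_metricI[OF Metric_space_dual dual_action_in_dual[OF assms(1)]])
  fix g :: 'g and \<epsilon> :: real assume \<epsilon>: "\<epsilon> > 0"
  have "\<forall>\<^sub>F u in nhds g. \<forall>w\<in>V. \<bar>\<phi> (h g w) - \<phi> (h u w)\<bar> \<le> \<epsilon> / 2 * N w"
    \<comment> \<open>Half of \<open>\<epsilon>\<close> is used because \<open>dual_norm_le\<close>
      yields a weak inequality and a strict one is required.\<close>
    using \<epsilon> by (intro assms(2)) simp
  then show "\<forall>\<^sub>F u in nhds g. dist_on (dual V N) (\<lambda>\<phi> \<theta>. dual_norm V N (\<lambda>v. \<phi> v - \<theta> v))
               (dual_action V h g \<phi>) (dual_action V h u \<phi>) < \<epsilon>"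
  proof eventually_elim
    case (elim u)
    have "dual_norm V N (\<lambda>w. dual_action V h g \<phi> w - dual_action V h u \<phi> w) \<le> \<epsilon> / 2"
      using elim \<epsilon> by (intro dual_norm_le) (simp_all add: dual_action_def)
    then show ?case using \<epsilon> by (simp add: dist_on_def)
  qed
qed

end

text \<open>Strong continuity at \<open>v\<close> gives the first clause. Each \<open>k\<close> in
  the hull is a matrix coefficient of \<open>v\<close> with some \<open>\<phi>\<close> in the orbit
  closure, and all vectors \<open>h g v\<close> have the norm of \<open>v\<close>, so norm
  continuity of \<open>\<phi>\<close> gives the second.\<close>

lemma SUC_representation_imp_criterion:
  fixes f :: "'g::topological_group_add \<Rightarrow>\<^sub>C real"
  assumes "SUC_representation V N h v \<psi> f"
  shows "SUC_criterion f"
proof -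
  have banach: "banach_space_on V N" and corep: "continuous_corep V N h"
    and v: "v \<in> V" and \<psi>: "\<psi> \<in> dual V N"
    and cont: "\<And>\<phi>. \<phi> \<in> orbit_closure V N h \<psi> \<Longrightarrow> norm_G_continuous V N h \<phi>"
    and f: "\<And>g. apply_bcontfun f g = \<psi> (h g v)"
    using assms by (simp_all add: SUC_representation_def matrix_coefficient_def)
  interpret banach_corep V N h using banach corep by unfold_locales
  have "functional \<psi>" using \<psi> by (simp add: dual_iff)
  then obtain C where C: "\<forall>w\<in>V. \<bar>\<psi> w\<bar> \<le> C * N w" unfolding functional_def by blast
  define B where "B = \<bar>C\<bar> + 1"
  have B_pos: "B > 0" by (simp add: B_def)
  have B: "\<bar>\<psi> w\<bar> \<le> B * N w" if "w \<in> V" for w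
  proof -
    have "\<bar>\<psi> w\<bar> \<le> C * N w" using C that by blast
    also have "\<dots> \<le> B * N w" by (intro mult_right_mono N_nonneg that) (simp add: B_def)
    finally show ?thesis .
  qed
  have "\<forall>\<^sub>F u in nhds 0. \<forall>x. \<bar>apply_bcontfun f (u + x) - apply_bcontfun f x\<bar> < \<epsilon>"
    if "\<epsilon> > 0" for \<epsilon>
  proof -
    have "\<epsilon> / B > 0" using that B_pos by simp
    from strong_continuity[OF v this, of 0] show ?thesis
    proof eventually_elim
      case (elim u)
      show ?case
      proof
        fix x
        have d: "h 0 v - h u v \<in> V" using v by (simp add: h_in_V subspace_diff[OF subspace_V])
        \<comment> \<open>With \<open>x\<close> written as \<open>0 + x\<close>, both terms factor
          through the isometry \<open>h x\<close>, and the bound becomes independent of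
          \<open>x\<close>.\<close>
        have "apply_bcontfun f x - apply_bcontfun f (u + x) = \<psi> (h (0 + x) v) - \<psi> (h (u + x) v)"
          by (simp add: f)
        also have "\<dots> = \<psi> (h x (h 0 v - h u v))"
          using v \<open>functional \<psi>\<close> unfolding h_add[OF v]
          by (simp add: h_minus h_in_V functional_minus)
        finally have "\<bar>apply_bcontfun f x - apply_bcontfun f (u + x)\<bar> \<le> B * N (h 0 v - h u v)"
          using B[OF h_in_V[OF d], of x] by (simp add: N_h d)
        also have "\<dots> < \<epsilon>" using elim B_pos by (simp add: pos_less_divide_eq mult.commute)
        finally show "\<bar>apply_bcontfun f (u + x) - apply_bcontfun f x\<bar> < \<epsilon>" by simp
      qed
    qed
  qed
  moreover have "\<forall>\<^sub>F u in nhds 0. \<forall>g. \<bar>k (g + u) - k g\<bar> < \<epsilon>"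
    if k: "k \<in> right_hull f" and \<epsilon>: "\<epsilon> > 0" for k \<epsilon>
  proof -
    let ?X = "product_topology (\<lambda>_. euclideanreal) V"
    let ?\<Phi> = "\<lambda>\<phi> g. \<phi> (h g v)"
    have "continuous_map ?X euclidean ?\<Phi>"
      by (intro continuous_map_fun_euclidean continuous_map_product_projection h_in_V v)
    moreover have "range (\<lambda>x g. apply_bcontfun f (g + x)) \<subseteq> ?\<Phi> ` orbit_closure V N h \<psi>"
    proof clarify
      fix x
      have "dual_action V h x \<psi> \<in> orbit_closure V N h \<psi>"
        unfolding orbit_closure_eq(1)[OF \<psi>]
        by (rule subsetD[OF closure_of_subset]) (auto simp: dual_action_def)
      moreover have "(\<lambda>g. apply_bcontfun f (g + x)) = ?\<Phi> (dual_action V h x \<psi>)"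
        using v by (simp add: f h_add dual_action_def h_in_V)
      ultimately show "(\<lambda>g. apply_bcontfun f (g + x)) \<in> ?\<Phi> ` orbit_closure V N h \<psi>" by blast
    qed
    ultimately have "right_hull f \<subseteq> ?\<Phi> ` orbit_closure V N h \<psi>"
      unfolding right_hull_def
      using continuous_map_image_compact_closure[OF orbit_closure_eq(2)[OF \<psi>]] by blast
    with k obtain \<phi> where \<phi>: "\<phi> \<in> orbit_closure V N h \<psi>" and k_eq: "k = ?\<Phi> \<phi>" by blast
    have "orbit_closure V N h \<psi> \<subseteq> dual V N"
      using closure_of_subset_topspace[of "weak_star_topology V N"]
      by (auto simp: orbit_closure_def weak_star_topology_def)
    with \<phi> have \<phi>d: "\<phi> \<in> dual V N" by blast
    \<comment> \<open>The summand \<open>1\<close> allows for \<open>v = 0\<close>.\<close>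
    define \<delta> where "\<delta> = \<epsilon> / (N v + 1)"
    have \<delta>: "\<delta> > 0" "\<delta> * N v < \<epsilon>"
      using \<epsilon> N_nonneg[OF v] by (auto simp: \<delta>_def field_simps)
    from norm_G_continuousD[OF \<phi>d cont[OF \<phi>] \<delta>(1), of 0] show ?thesis
    proof eventually_elim
      case (elim u)
      show ?case
      proof
        fix g
        have "\<bar>\<phi> (h 0 (h g v)) - \<phi> (h u (h g v))\<bar> \<le> \<delta> * N v"
          using elim h_in_V[OF v] N_h[OF v] by metis
        moreover have "k (g + u) = \<phi> (h u (h g v))" "k g = \<phi> (h 0 (h g v))"
          using h_add[OF v, of g u] h_add[OF v, of g 0] by (simp_all add: k_eq)
        ultimately show "\<bar>k (g + u) - k g\<bar> < \<epsilon>" using \<delta>(2) by linarith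
      qed
    qed
  qed
  ultimately show ?thesis unfolding SUC_criterion_def by blast
qed

section \<open>From the intrinsic condition to a representation\<close>

definition left_translate :: "'g::topological_group_add \<Rightarrow> ('g \<Rightarrow>\<^sub>C real) \<Rightarrow> ('g \<Rightarrow>\<^sub>C real)" where
  "left_translate g w = Bcontfun (\<lambda>x. apply_bcontfun w (g + x))"

lemma apply_left_translate [simp]:
  "apply_bcontfun (left_translate g w) x = apply_bcontfun w (g + x)"
proof -
  have "continuous_on UNIV (\<lambda>x. apply_bcontfun w (g + x))"
    by (intro continuous_on_compose2[OF continuous_on_apply_bcontfun[of UNIV w]] continuous_intros) auto
  moreover have "bounded (range (\<lambda>x. apply_bcontfun w (g + x)))"
    by (rule bounded_subset[OF bounded_apply_bcontfun[of w]]) auto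
  ultimately show ?thesis by (simp add: left_translate_def Bcontfun_inverse bcontfun_def)
qed

text \<open>Composition reverses the order of the group elements, as a co-representation
  requires.\<close>

lemma left_translate_add: "left_translate (g + h) w = left_translate h (left_translate g w)"
  and left_translate_0: "left_translate 0 w = w"
  and left_translate_plus: "left_translate g (w + z) = left_translate g w + left_translate g z"
  and left_translate_minus: "left_translate g (w - z) = left_translate g w - left_translate g z"
  and left_translate_scaleR: "left_translate g (c *\<^sub>R w) = c *\<^sub>R left_translate g w"
  by (auto intro!: bcontfun_eqI simp: add.assoc)

lemma norm_left_translate_le: "norm (left_translate g w) \<le> norm w"
  by (rule norm_bound) (auto intro: abs_le_norm_bcontfun)

text \<open>The library has completeness of spaces of bounded continuous functions only for metric domains.\<close>

lemma Cauchy_bcontfun_tendsto: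
  fixes \<sigma> :: "nat \<Rightarrow> 'a::topological_space \<Rightarrow>\<^sub>C 'b::complete_space"
  assumes "Cauchy \<sigma>"
  obtains w where "\<sigma> \<longlonglongrightarrow> w"
proof -
  have "\<exists>n0. \<forall>m n x. n0 \<le> m \<and> n0 \<le> n \<and> True \<longrightarrow> dist (\<sigma> m x) (\<sigma> n x) < \<epsilon>" if "\<epsilon> > 0" for \<epsilon>
    using assms that unfolding Cauchy_def by (meson dist_fun_lt_imp_dist_val_lt)
  then obtain g where "uniform_limit UNIV (\<lambda>n. apply_bcontfun (\<sigma> n)) g sequentially"
    using uniformly_convergent_eq_cauchy[of "\<lambda>_. True" "\<lambda>n. apply_bcontfun (\<sigma> n)"]
    unfolding uniform_limit_sequentially_iff by auto
  then show thesis using uniform_limit_bcontfunE[OF _ sequentially_bot] that by metis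
qed

text \<open>These functionals are the points of the Stone-Cech compactification.\<close>

definition limit_evaluations :: "(('g::topological_space \<Rightarrow>\<^sub>C real) \<Rightarrow> real) set" where
  "limit_evaluations = closure (range (\<lambda>x w. apply_bcontfun w x))"

lemma evaluation_in_limit_evaluations: "(\<lambda>w. apply_bcontfun w x) \<in> limit_evaluations"
  unfolding limit_evaluations_def by (rule subsetD[OF closure_subset]) blast

lemma compact_limit_evaluations: "compact (limit_evaluations :: (('g::topological_space \<Rightarrow>\<^sub>C real) \<Rightarrow> real) set)"
  unfolding limit_evaluations_def
  by (intro compact_closure_pointwise_bounded[of _ norm]) (auto intro: abs_le_norm_bcontfun)

text \<open>Continuous maps send closures into closures. The two instances below translate limit
  evaluations and map them into the hull.\<close>

lemma limit_evaluations_image: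
  fixes T :: "(('g::topological_space \<Rightarrow>\<^sub>C real) \<Rightarrow> real) \<Rightarrow> 'i \<Rightarrow> real"
  assumes "\<phi> \<in> limit_evaluations" "\<And>i. continuous_map euclidean euclideanreal (\<lambda>\<phi>. T \<phi> i)"
  shows "T \<phi> \<in> closure (range (\<lambda>x. T (\<lambda>w. apply_bcontfun w x)))"
proof -
  have "continuous_map euclidean euclidean T"
    using assms(2) by (rule continuous_map_fun_euclidean)
  from continuous_map_image_closure_subset[OF this, of "range (\<lambda>x w. apply_bcontfun w x)"] assms(1)
  show ?thesis by (auto simp: limit_evaluations_def image_image)
qed

lemma limit_evaluations_translate:
  assumes "\<phi> \<in> limit_evaluations"
  shows "(\<lambda>w. \<phi> (left_translate g w)) \<in> limit_evaluations"
  using limit_evaluations_image[OF assms, of "\<lambda>\<phi> w. \<phi> (left_translate g w)"]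
    closure_mono[of "range (\<lambda>x w. apply_bcontfun w (g + x))" "range (\<lambda>x w. apply_bcontfun w x)"]
  by (auto simp: limit_evaluations_def continuous_map_eval)

text \<open>For evaluation at \<open>x\<close> this function is the translate of \<open>f\<close> by
  \<open>x\<close>. The second clause of the criterion thereby becomes a statement about
  functionals.\<close>

lemma limit_evaluations_right_hull:
  assumes "\<phi> \<in> limit_evaluations"
  shows "(\<lambda>g. \<phi> (left_translate g f)) \<in> right_hull f"
  using limit_evaluations_image[OF assms, of "\<lambda>\<phi> g. \<phi> (left_translate g f)"]
  by (simp add: right_hull_def continuous_map_eval)

lemma limit_evaluations_le_norm:
  assumes "\<phi> \<in> limit_evaluations"
  shows "\<bar>\<phi> w\<bar> \<le> norm w"
  by (rule closure_fun_le[OF continuous_map_real_abs[OF continuous_map_eval]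
        _ assms[unfolded limit_evaluations_def]])
    (auto intro: abs_le_norm_bcontfun)

lemma limit_evaluations_add:
  assumes "\<phi> \<in> limit_evaluations"
  shows "\<phi> (w + z) = \<phi> w + \<phi> z"
proof -
  have "continuous_map euclidean euclideanreal
      (\<lambda>\<phi> :: ('a \<Rightarrow>\<^sub>C real) \<Rightarrow> real. \<bar>\<phi> (w + z) - (\<phi> w + \<phi> z)\<bar>)"
    by (intro continuous_map_real_abs continuous_map_diff continuous_map_add continuous_map_eval)
  then have "\<bar>\<phi> (w + z) - (\<phi> w + \<phi> z)\<bar> \<le> 0"
    by (rule closure_fun_le[OF _ _ assms[unfolded limit_evaluations_def]]) auto
  then show ?thesis by simp
qed

lemma limit_evaluations_scaleR:
  assumes "\<phi> \<in> limit_evaluations"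
  shows "\<phi> (c *\<^sub>R w) = c * \<phi> w"
proof -
  have "continuous_map euclidean euclideanreal
      (\<lambda>\<phi> :: ('a \<Rightarrow>\<^sub>C real) \<Rightarrow> real. \<bar>\<phi> (c *\<^sub>R w) - c * \<phi> w\<bar>)"
    by (intro continuous_map_real_abs continuous_map_diff continuous_map_real_mult_left continuous_map_eval)
  then have "\<bar>\<phi> (c *\<^sub>R w) - c * \<phi> w\<bar> \<le> 0"
    by (rule closure_fun_le[OF _ _ assms[unfolded limit_evaluations_def]]) auto
  then show ?thesis by simp
qed

lemma limit_evaluations_diff:
  assumes "\<phi> \<in> limit_evaluations"
  shows "\<phi> (w - z) = \<phi> w - \<phi> z"
  using limit_evaluations_add[OF assms, of "w - z" z] by simp

lemma limit_evaluations_zero: "\<phi> \<in> limit_evaluations \<Longrightarrow> \<phi> 0 = 0"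
  using limit_evaluations_scaleR[of \<phi> 0 0] by simp

section \<open>The Hoelder norm\<close>

locale holder_space =
  fixes f :: "'g::topological_group_add \<Rightarrow>\<^sub>C real"
begin

abbreviation M where "M \<equiv> limit_evaluations :: (('g \<Rightarrow>\<^sub>C real) \<Rightarrow> real) set"

definition orbit_dist :: "(('g \<Rightarrow>\<^sub>C real) \<Rightarrow> real) \<Rightarrow> (('g \<Rightarrow>\<^sub>C real) \<Rightarrow> real) \<Rightarrow> real" where
  "orbit_dist \<phi> \<theta> = (SUP g. \<bar>\<phi> (left_translate g f) - \<theta> (left_translate g f)\<bar>)"

lemma orbit_dist_bounds:
  assumes "\<phi> \<in> M" "\<theta> \<in> M"
  shows "\<bar>\<phi> (left_translate g f) - \<theta> (left_translate g f)\<bar> \<le> orbit_dist \<phi> \<theta>"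
    and "0 \<le> orbit_dist \<phi> \<theta>" and "orbit_dist \<phi> \<theta> \<le> 2 * norm f"
proof -
  have b: "\<bar>\<phi> (left_translate g f) - \<theta> (left_translate g f)\<bar> \<le> 2 * norm f" for g
    using limit_evaluations_le_norm[OF assms(1), of "left_translate g f"]
      limit_evaluations_le_norm[OF assms(2), of "left_translate g f"]
      norm_left_translate_le[of g f] by linarith
  show *: "\<bar>\<phi> (left_translate g f) - \<theta> (left_translate g f)\<bar> \<le> orbit_dist \<phi> \<theta>" for g
    unfolding orbit_dist_def using b by (intro cSUP_upper bdd_aboveI2[of _ _ "2 * norm f"]) auto
  show "0 \<le> orbit_dist \<phi> \<theta>" using *[of 0] by linarith
  show "orbit_dist \<phi> \<theta> \<le> 2 * norm f" unfolding orbit_dist_def by (rule cSUP_least) (auto intro: b)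
qed

lemma orbit_dist_le:
  assumes "\<And>g. \<bar>\<phi> (left_translate g f) - \<theta> (left_translate g f)\<bar> \<le> c"
  shows "orbit_dist \<phi> \<theta> \<le> c"
  unfolding orbit_dist_def using assms by (intro cSUP_least) auto

text \<open>Translating both functionals by \<open>u\<close> only replaces the index
  \<open>g\<close> of the supremum by \<open>g + u\<close>.\<close>

lemma orbit_dist_translate:
  assumes "\<phi> \<in> M" "\<theta> \<in> M"
  shows "orbit_dist (\<lambda>w. \<phi> (left_translate u w)) (\<lambda>w. \<theta> (left_translate u w)) \<le> orbit_dist \<phi> \<theta>"
  using orbit_dist_bounds(1)[OF assms] by (intro orbit_dist_le) (simp add: left_translate_add[symmetric])

text \<open>One constant controls both the sup norm and the Hoelder constant of exponent
  \<open>1/2\<close>. The sup norm makes \<open>N\<close> definite and lets Cauchy sequences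
  converge uniformly.\<close>

definition bound :: "('g \<Rightarrow>\<^sub>C real) \<Rightarrow> real \<Rightarrow> bool" where
  "bound w C \<longleftrightarrow> norm w \<le> C \<and> (\<forall>\<phi>\<in>M. \<forall>\<theta>\<in>M. \<bar>\<phi> w - \<theta> w\<bar> \<le> C * sqrt (orbit_dist \<phi> \<theta>))"

lemma boundI:
  assumes "norm w \<le> C" "\<And>\<phi> \<theta>. \<phi> \<in> M \<Longrightarrow> \<theta> \<in> M \<Longrightarrow> \<bar>\<phi> w - \<theta> w\<bar> \<le> C * sqrt (orbit_dist \<phi> \<theta>)"
  shows "bound w C"
  using assms by (simp add: bound_def)

lemma boundD:
  assumes "bound w C"
  shows "norm w \<le> C" "0 \<le> C" "\<phi> \<in> M \<Longrightarrow> \<theta> \<in> M \<Longrightarrow> \<bar>\<phi> w - \<theta> w\<bar> \<le> C * sqrt (orbit_dist \<phi> \<theta>)"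
  using assms order_trans[OF norm_ge_zero[of w]] by (auto simp: bound_def)

lemma bound_mono:
  assumes "bound w C" "C \<le> D"
  shows "bound w D"
proof (rule boundI)
  show "norm w \<le> D" using boundD(1)[OF assms(1)] assms(2) by linarith
  fix \<phi> \<theta> assume "\<phi> \<in> M" "\<theta> \<in> M"
  then have "\<bar>\<phi> w - \<theta> w\<bar> \<le> C * sqrt (orbit_dist \<phi> \<theta>)" "0 \<le> orbit_dist \<phi> \<theta>"
    using boundD(3)[OF assms(1)] orbit_dist_bounds(2) by blast+
  then show "\<bar>\<phi> w - \<theta> w\<bar> \<le> D * sqrt (orbit_dist \<phi> \<theta>)"
    using mult_right_mono[OF assms(2), of "sqrt (orbit_dist \<phi> \<theta>)"] by simp
qed

lemma bound_0: "bound 0 0"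
  by (simp add: bound_def limit_evaluations_zero)

lemma bound_add:
  assumes "bound w C" "bound z D"
  shows "bound (w + z) (C + D)"
proof (rule boundI)
  show "norm (w + z) \<le> C + D"
    using norm_triangle_ineq[of w z] boundD(1)[OF assms(1)] boundD(1)[OF assms(2)] by linarith
  show "\<bar>\<phi> (w + z) - \<theta> (w + z)\<bar> \<le> (C + D) * sqrt (orbit_dist \<phi> \<theta>)" if "\<phi> \<in> M" "\<theta> \<in> M" for \<phi> \<theta>
    using boundD(3)[OF assms(1) that] boundD(3)[OF assms(2) that] that
    by (simp add: limit_evaluations_add distrib_right)
qed

lemma bound_scaleR:
  assumes "bound w C"
  shows "bound (c *\<^sub>R w) (\<bar>c\<bar> * C)"
proof (rule boundI)
  show "norm (c *\<^sub>R w) \<le> \<bar>c\<bar> * C" using boundD(1)[OF assms] by (simp add: mult_left_mono)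
  show "\<bar>\<phi> (c *\<^sub>R w) - \<theta> (c *\<^sub>R w)\<bar> \<le> \<bar>c\<bar> * C * sqrt (orbit_dist \<phi> \<theta>)" if "\<phi> \<in> M" "\<theta> \<in> M" for \<phi> \<theta>
    using mult_left_mono[OF boundD(3)[OF assms that], of "\<bar>c\<bar>"] that
    by (simp add: limit_evaluations_scaleR right_diff_distrib[symmetric] abs_mult mult.assoc)
qed

text \<open>Translation maps \<open>M\<close> into itself and does not increase
  \<open>orbit_dist\<close>, so Hoelder constants are preserved.\<close>

lemma bound_translate:
  assumes "bound w C"
  shows "bound (left_translate g w) C"
proof (rule boundI)
  show "norm (left_translate g w) \<le> C"
    using norm_left_translate_le[of g w] boundD(1)[OF assms] by linarith
  fix \<phi> \<theta> assume \<phi>: "\<phi> \<in> M" and \<theta>: "\<theta> \<in> M"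
  have "\<bar>\<phi> (left_translate g w) - \<theta> (left_translate g w)\<bar> \<le>
      C * sqrt (orbit_dist (\<lambda>w. \<phi> (left_translate g w)) (\<lambda>w. \<theta> (left_translate g w)))"
    using \<phi> \<theta> by (intro boundD(3)[OF assms] limit_evaluations_translate)
  also have "\<dots> \<le> C * sqrt (orbit_dist \<phi> \<theta>)"
    using orbit_dist_translate[OF \<phi> \<theta>] boundD(2)[OF assms] by (intro mult_left_mono) auto
  finally show "\<bar>\<phi> (left_translate g w) - \<theta> (left_translate g w)\<bar> \<le> C * sqrt (orbit_dist \<phi> \<theta>)" .
qed

lemma limit_evaluations_tendsto:
  assumes "\<phi> \<in> M" "\<sigma> \<longlonglongrightarrow> w"
  shows "(\<lambda>n. \<phi> (\<sigma> n)) \<longlonglongrightarrow> \<phi> w"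
proof (rule LIM_zero_cancel, rule Lim_null_comparison)
  show "\<forall>\<^sub>F n in sequentially. norm (\<phi> (\<sigma> n) - \<phi> w) \<le> norm (\<sigma> n - w)"
    using limit_evaluations_le_norm[OF assms(1)]
    by (simp add: limit_evaluations_diff[OF assms(1), symmetric])
  show "(\<lambda>n. norm (\<sigma> n - w)) \<longlonglongrightarrow> 0"
    using assms(2) by (simp add: LIM_zero tendsto_norm_zero)
qed

text \<open>Elements of \<open>M\<close> are continuous for the sup norm, so every inequality in
  \<open>bound\<close> survives uniform limits. Completeness rests on this.\<close>

lemma bound_limit:
  assumes "\<sigma> \<longlonglongrightarrow> w" "\<forall>\<^sub>F n in sequentially. bound (\<sigma> n) C"
  shows "bound w C"
proof (rule boundI)
  show "norm w \<le> C"
    using tendsto_norm[OF assms(1)] eventually_mono[OF assms(2) boundD(1)]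
    by (rule tendsto_upperbound) (assumption | rule sequentially_bot)+
  fix \<phi> \<theta> assume \<phi>: "\<phi> \<in> M" and \<theta>: "\<theta> \<in> M"
  have "(\<lambda>n. \<bar>\<phi> (\<sigma> n) - \<theta> (\<sigma> n)\<bar>) \<longlonglongrightarrow> \<bar>\<phi> w - \<theta> w\<bar>"
    by (intro tendsto_rabs tendsto_diff limit_evaluations_tendsto assms(1) \<phi> \<theta>)
  then show "\<bar>\<phi> w - \<theta> w\<bar> \<le> C * sqrt (orbit_dist \<phi> \<theta>)"
    using eventually_mono[OF assms(2) boundD(3)[OF _ \<phi> \<theta>]] by (rule tendsto_upperbound) (assumption | rule sequentially_bot)+
qed

definition N :: "('g \<Rightarrow>\<^sub>C real) \<Rightarrow> real" where
  "N w = Inf {C. bound w C}"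

lemma N_le: "bound w C \<Longrightarrow> N w \<le> C"
  unfolding N_def using boundD(2) by (intro cInf_lower bdd_belowI[of _ 0]) auto

text \<open>The infimum defining \<open>N\<close> is attained, since each constraint on
  \<open>C\<close> is a weak lower bound.\<close>

lemma bound_N:
  assumes "bound w C"
  shows "bound w (N w)"
proof (rule boundI)
  have ne: "{C. bound w C} \<noteq> {}" using assms by blast
  show "norm w \<le> N w" unfolding N_def using boundD(1) by (intro cInf_greatest[OF ne]) auto
  fix \<phi> \<theta> assume \<phi>: "\<phi> \<in> M" and \<theta>: "\<theta> \<in> M"
  show "\<bar>\<phi> w - \<theta> w\<bar> \<le> N w * sqrt (orbit_dist \<phi> \<theta>)"
  proof (cases "orbit_dist \<phi> \<theta> = 0")
    \<comment> \<open>Division by the distance is impossible here, but any admissible constant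
      already forces \<open>\<phi> w = \<theta> w\<close>.\<close>
    case True
    then show ?thesis using boundD(3)[OF assms \<phi> \<theta>] by simp
  next
    case False
    then have pos: "sqrt (orbit_dist \<phi> \<theta>) > 0" using orbit_dist_bounds(2)[OF \<phi> \<theta>] by simp
    have "\<bar>\<phi> w - \<theta> w\<bar> / sqrt (orbit_dist \<phi> \<theta>) \<le> N w"
      unfolding N_def using boundD(3)[OF _ \<phi> \<theta>] pos
      by (intro cInf_greatest[OF ne]) (simp add: pos_divide_le_eq)
    then show ?thesis using pos by (simp add: pos_divide_le_eq)
  qed
qed

definition V0 :: "('g \<Rightarrow>\<^sub>C real) set" where "V0 = {w. \<exists>C. bound w C}"

lemma V0_bound: "w \<in> V0 \<Longrightarrow> bound w (N w)"
  using bound_N by (auto simp: V0_def)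

lemma V0_I: "bound w C \<Longrightarrow> w \<in> V0"
  by (auto simp: V0_def)

lemma subspace_V0: "subspace V0"
proof (rule subspaceI)
  show "0 \<in> V0" by (rule V0_I[OF bound_0])
qed (auto simp: V0_def intro: bound_add bound_scaleR)

lemma N_nonneg: "w \<in> V0 \<Longrightarrow> 0 \<le> N w"
  using boundD(2) V0_bound by blast

lemma norm_le_N: "w \<in> V0 \<Longrightarrow> norm w \<le> N w"
  using boundD(1) V0_bound by blast

lemma N_0: "N 0 = 0"
  using N_le[OF bound_0] N_nonneg[OF V0_I[OF bound_0]] by simp

lemma N_eq_0: "w \<in> V0 \<Longrightarrow> N w = 0 \<longleftrightarrow> w = 0"
  using norm_le_N[of w] N_0 by auto

lemma N_add: "w \<in> V0 \<Longrightarrow> z \<in> V0 \<Longrightarrow> N (w + z) \<le> N w + N z"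
  by (intro N_le bound_add V0_bound)

lemma N_scaleR:
  assumes "w \<in> V0"
  shows "N (c *\<^sub>R w) = \<bar>c\<bar> * N w"
proof (cases "c = 0")
  case True
  then show ?thesis by (simp add: N_0)
next
  case False
  \<comment> \<open>This inequality is applied to \<open>c\<close> and to \<open>1 / c\<close>,
    which gives equality.\<close>
  have le: "N (a *\<^sub>R z) \<le> \<bar>a\<bar> * N z" if "z \<in> V0" for a z
    using that by (intro N_le bound_scaleR V0_bound)
  have "N w = N ((1 / c) *\<^sub>R (c *\<^sub>R w))" using False by simp
  also have "\<dots> \<le> \<bar>1 / c\<bar> * N (c *\<^sub>R w)"
    by (rule le[OF subspace_scale[OF subspace_V0 assms]])
  finally have "\<bar>c\<bar> * N w \<le> N (c *\<^sub>R w)" using False by (simp add: field_simps abs_divide)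
  with le[OF assms, of c] show ?thesis by simp
qed

lemma V0_translate: "w \<in> V0 \<Longrightarrow> left_translate g w \<in> V0"
  by (rule V0_I[OF bound_translate[OF V0_bound]])

text \<open>Translations are contractions, and so are their inverses.\<close>

lemma N_translate:
  assumes "w \<in> V0"
  shows "N (left_translate g w) = N w"
proof (rule antisym)
  show "N (left_translate g w) \<le> N w" by (rule N_le[OF bound_translate[OF V0_bound[OF assms]]])
  have "N (left_translate (- g) (left_translate g w)) \<le> N (left_translate g w)"
    by (rule N_le[OF bound_translate[OF V0_bound[OF V0_translate[OF assms]]]])
  then show "N w \<le> N (left_translate g w)"
    by (simp add: left_translate_add[symmetric] left_translate_0)
qed

lemma N_minus_commute: "w \<in> V0 \<Longrightarrow> z \<in> V0 \<Longrightarrow> N (z - w) = N (w - z)"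
  using N_scaleR[of "w - z" "-1"] subspace_diff[OF subspace_V0] by simp

section \<open>The Banach space of continuous vectors\<close>

definition V :: "('g \<Rightarrow>\<^sub>C real) set" where
  "V = {w \<in> V0. ((\<lambda>u. N (left_translate u w - w)) \<longlongrightarrow> 0) (nhds 0)}"

lemma V_V0: "w \<in> V \<Longrightarrow> w \<in> V0"
  by (simp add: V_def)

lemma V_I:
  assumes "w \<in> V0" "\<And>\<epsilon>. \<epsilon> > 0 \<Longrightarrow> \<forall>\<^sub>F u in nhds 0. N (left_translate u w - w) < \<epsilon>"
  shows "w \<in> V"
proof -
  have "0 \<le> N (left_translate u w - w)" for u
    by (intro N_nonneg subspace_diff[OF subspace_V0] V0_translate assms(1))
  with assms show ?thesis
    by (auto simp: V_def intro!: tendstoI elim: eventually_mono)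
qed

lemma V_D:
  assumes "w \<in> V" "\<epsilon> > 0"
  shows "\<forall>\<^sub>F u in nhds 0. N (left_translate u w - w) < \<epsilon>"
  using assms by (auto simp: V_def intro: order_tendstoD(2))

lemma subspace_V: "subspace V"
proof (rule subspaceI)
  have "left_translate u 0 = 0" for u :: 'g using left_translate_scaleR[of u 0 0] by simp
  then show "0 \<in> V" using subspace_0[OF subspace_V0] by (simp add: V_def N_0)
  show "w + z \<in> V" if w: "w \<in> V" and z: "z \<in> V" for w z
  proof (rule V_I)
    show "w + z \<in> V0" using w z by (intro subspace_add[OF subspace_V0] V_V0)
    fix \<epsilon> :: real assume "\<epsilon> > 0"
    then have "\<epsilon> / 2 > 0" by simp
    from V_D[OF w this] V_D[OF z this]
    show "\<forall>\<^sub>F u in nhds 0. N (left_translate u (w + z) - (w + z)) < \<epsilon>"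
    proof eventually_elim
      case (elim u)
      have "left_translate u (w + z) - (w + z) = (left_translate u w - w) + (left_translate u z - z)"
        by (simp add: left_translate_plus)
      also have "N \<dots> \<le> N (left_translate u w - w) + N (left_translate u z - z)"
        using w z by (intro N_add subspace_diff[OF subspace_V0] V0_translate V_V0)
      finally show ?case using elim by linarith
    qed
  qed
  show "c *\<^sub>R w \<in> V" if w: "w \<in> V" for c w
  proof -
    have "N (left_translate u (c *\<^sub>R w) - c *\<^sub>R w) = \<bar>c\<bar> * N (left_translate u w - w)" for u
      using N_scaleR[of "left_translate u w - w" c] w
      by (simp add: left_translate_scaleR scaleR_diff_right subspace_diff[OF subspace_V0] V0_translate V_V0)
    moreover have "((\<lambda>u. \<bar>c\<bar> * N (left_translate u w - w)) \<longlongrightarrow> \<bar>c\<bar> * 0) (nhds 0)"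
      using w unfolding V_def by (intro tendsto_mult_left) simp
    ultimately show ?thesis
      using w subspace_scale[OF subspace_V0] by (simp add: V_def)
  qed
qed

text \<open>Since \<open>u\<close> is \<open>(u + - g) + g\<close> and translation by
  \<open>g\<close> is isometric, continuity of an orbit map at \<open>g\<close> reduces to
  continuity at \<open>0\<close>.\<close>

lemma N_translate_diff:
  assumes "w \<in> V0"
  shows "N (left_translate g w - left_translate u w) = N (left_translate (u + - g) w - w)"
proof -
  have u: "u = (u + - g) + g" by (simp add: add.assoc)
  have "left_translate u w = left_translate g (left_translate (u + - g) w)"
    by (subst u) (rule left_translate_add)
  then have "N (left_translate g w - left_translate u w) = N (left_translate g (w - left_translate (u + - g) w))"
    by (simp add: left_translate_minus)
  also have "\<dots> = N (w - left_translate (u + - g) w)"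
    by (intro N_translate subspace_diff[OF subspace_V0] V0_translate assms)
  also have "\<dots> = N (left_translate (u + - g) w - w)"
    by (intro N_minus_commute V0_translate assms)
  finally show ?thesis .
qed

lemma eventually_N_translate:
  assumes "w \<in> V" "\<epsilon> > 0"
  shows "\<forall>\<^sub>F u in nhds g. N (left_translate g w - left_translate u w) < \<epsilon>"
proof -
  have "((\<lambda>u. u + - g) \<longlongrightarrow> 0) (nhds g)" using tendsto_conjugate_0[of 0 g] by simp
  from eventually_compose_filterlim[OF V_D[OF assms] this] show ?thesis
    by (simp only: N_translate_diff[OF V_V0[OF assms(1)]])
qed

lemma V_translate:
  assumes "w \<in> V"
  shows "left_translate g w \<in> V"
proof (rule V_I)
  show "left_translate g w \<in> V0" by (rule V0_translate[OF V_V0[OF assms]])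
  fix \<epsilon> :: real assume "\<epsilon> > 0"
  have "((\<lambda>u. g + u) \<longlongrightarrow> g + 0) (nhds 0)" by (intro tendsto_intros filterlim_ident)
  then have "((\<lambda>u. g + u) \<longlongrightarrow> g) (nhds 0)" by simp
  from eventually_compose_filterlim[OF eventually_N_translate[OF assms \<open>\<epsilon> > 0\<close>] this]
  show "\<forall>\<^sub>F u in nhds 0. N (left_translate u (left_translate g w) - left_translate g w) < \<epsilon>"
  proof eventually_elim
    case (elim u)
    then show ?case
      using N_minus_commute[OF V0_translate V0_translate, OF V_V0 V_V0, OF assms assms, of "g + u" g]
      by (simp add: left_translate_add)
  qed
qed

lemma Metric_space_V: "Metric_space V (norm_dist V N)"
  by (rule Metric_space_norm_dist[OF subspace_V])
    (simp_all add: V_V0 N_nonneg N_eq_0 N_scaleR N_add)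

text \<open>A Cauchy sequence for \<open>N\<close> has a uniform limit. The limit is also one for
  \<open>N\<close> because \<open>bound\<close> is closed, and it is again a continuous vector
  because translations are isometries.\<close>

lemma mcomplete_V: "Metric_space.mcomplete V (norm_dist V N)"
proof -
  interpret Metric_space V "norm_dist V N" by (rule Metric_space_V)
  have V_diff: "a - b \<in> V0" if "a \<in> V0" "b \<in> V0" for a b
    by (rule subspace_diff[OF subspace_V0 that])
  show ?thesis
    unfolding mcomplete_def
  proof (intro allI impI)
    fix \<sigma> assume "MCauchy \<sigma>"
    then have \<sigma>: "\<And>n. \<sigma> n \<in> V"
      and cauchy: "\<And>\<epsilon>. \<epsilon> > 0 \<Longrightarrow> \<exists>n0. \<forall>m n. n0 \<le> m \<longrightarrow> n0 \<le> n \<longrightarrow> N (\<sigma> m - \<sigma> n) < \<epsilon>"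
      unfolding MCauchy_def by (auto simp: norm_dist_eq range_subsetD)
    have \<sigma>0: "\<sigma> n \<in> V0" for n using \<sigma> V_V0 by blast
    have "Cauchy \<sigma>"
    proof (rule CauchyI)
      fix \<epsilon> :: real assume "\<epsilon> > 0"
      from cauchy[OF this] obtain n0 where "\<forall>m n. n0 \<le> m \<longrightarrow> n0 \<le> n \<longrightarrow> N (\<sigma> m - \<sigma> n) < \<epsilon>" by blast
      then show "\<exists>n0. \<forall>m\<ge>n0. \<forall>n\<ge>n0. norm (\<sigma> m - \<sigma> n) < \<epsilon>"
        using norm_le_N[OF V_diff[OF \<sigma>0 \<sigma>0]] by (meson le_less_trans)
    qed
    then obtain w where w: "\<sigma> \<longlonglongrightarrow> w" by (rule Cauchy_bcontfun_tendsto)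
    \<comment> \<open>With \<open>n\<close> fixed, let \<open>m\<close> tend to infinity in the
      bound for \<open>\<sigma> n - \<sigma> m\<close>.\<close>
    have close: "\<exists>n0. \<forall>n\<ge>n0. bound (\<sigma> n - w) \<epsilon>" if "\<epsilon> > 0" for \<epsilon>
    proof -
      from cauchy[OF that] obtain n0 where n0: "\<And>m n. n0 \<le> m \<Longrightarrow> n0 \<le> n \<Longrightarrow> N (\<sigma> m - \<sigma> n) < \<epsilon>" by blast
      have "bound (\<sigma> n - w) \<epsilon>" if n: "n \<ge> n0" for n
      proof (rule bound_limit)
        show "(\<lambda>m. \<sigma> n - \<sigma> m) \<longlonglongrightarrow> \<sigma> n - w" by (intro tendsto_intros w)
        show "\<forall>\<^sub>F m in sequentially. bound (\<sigma> n - \<sigma> m) \<epsilon>"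
          using eventually_ge_at_top[of n0]
        proof eventually_elim
          case (elim m)
          show ?case
            by (rule bound_mono[OF V0_bound[OF V_diff[OF \<sigma>0 \<sigma>0]] less_imp_le[OF n0[OF n elim]]])
        qed
      qed
      then show ?thesis by blast
    qed
    \<comment> \<open>\<open>w\<close> is recovered as \<open>\<sigma> n - (\<sigma> n - w)\<close>,
      a difference of elements of \<open>V0\<close>.\<close>
    from close[of 1] obtain n where "bound (\<sigma> n - w) 1" by auto
    from V_diff[OF \<sigma>0[of n] V0_I[OF this]] have w0: "w \<in> V0" by simp
    have wV: "w \<in> V"
    proof (rule V_I[OF w0])
      fix \<epsilon> :: real assume "\<epsilon> > 0"
      then have \<epsilon>: "\<epsilon> / 3 > 0" by simp
      from close[OF \<epsilon>] obtain n where n: "bound (\<sigma> n - w) (\<epsilon> / 3)" by blast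
      have d: "\<sigma> n - w \<in> V0" by (rule V_diff[OF \<sigma>0 w0])
      from V_D[OF \<sigma>[of n] \<epsilon>] show "\<forall>\<^sub>F u in nhds 0. N (left_translate u w - w) < \<epsilon>"
      proof eventually_elim
        case (elim u)
        let ?L = "left_translate u"
        \<comment> \<open>This is the three-epsilon splitting; the two terms with
          \<open>\<sigma> n - w\<close> have equal norm.\<close>
        have "?L w - w = (?L (\<sigma> n) - \<sigma> n) + ((\<sigma> n - w) + (-1) *\<^sub>R ?L (\<sigma> n - w))"
          by (simp add: left_translate_minus)
        also have "N \<dots> \<le> N (?L (\<sigma> n) - \<sigma> n) + N ((\<sigma> n - w) + (-1) *\<^sub>R ?L (\<sigma> n - w))"
          by (intro N_add V_diff subspace_add[OF subspace_V0] subspace_scale[OF subspace_V0] V0_translate \<sigma>0 w0)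
        also have "N ((\<sigma> n - w) + (-1) *\<^sub>R ?L (\<sigma> n - w)) \<le> N (\<sigma> n - w) + N ((-1) *\<^sub>R ?L (\<sigma> n - w))"
          by (intro N_add V_diff subspace_scale[OF subspace_V0] V0_translate \<sigma>0 w0)
        also have "N ((-1) *\<^sub>R ?L (\<sigma> n - w)) = N (\<sigma> n - w)"
          using N_scaleR[OF V0_translate[OF d], of "-1" u] N_translate[OF d] by simp
        also have "N (?L (\<sigma> n) - \<sigma> n) < \<epsilon> / 3" by (rule elim)
        finally show ?case using N_le[OF n] by linarith
      qed
    qed
    have "limitin mtopology \<sigma> w sequentially"
      unfolding limitin_metric
    proof (intro conjI allI impI)
      fix \<epsilon> :: real assume "\<epsilon> > 0"
      then have "\<epsilon> / 2 > 0" by simp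
      from close[OF this] obtain n0 where n0: "\<And>n. n \<ge> n0 \<Longrightarrow> bound (\<sigma> n - w) (\<epsilon> / 2)" by blast
      show "\<forall>\<^sub>F n in sequentially. \<sigma> n \<in> V \<and> norm_dist V N (\<sigma> n) w < \<epsilon>"
        using eventually_ge_at_top[of n0]
      proof eventually_elim
        case (elim n)
        then show ?case using N_le[OF n0] \<open>\<epsilon> > 0\<close> \<sigma> wV by (fastforce simp: norm_dist_eq)
      qed
    qed (rule wV)
    then show "\<exists>w. limitin mtopology \<sigma> w sequentially" by blast
  qed
qed

lemma banach_space_on_V: "banach_space_on V N"
  unfolding banach_space_on_def
  using subspace_V N_nonneg N_eq_0 N_scaleR N_add mcomplete_V V_V0 by simp

section \<open>The co-representation and its distinguished functional\<close>

definition h :: "'g \<Rightarrow> ('g \<Rightarrow>\<^sub>C real) \<Rightarrow> ('g \<Rightarrow>\<^sub>C real)" where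
  "h g = restrict (left_translate g) V"

lemma h_Iso: "h g \<in> Iso V N"
proof -
  have "linear_within V (h g)"
    by (simp add: linear_within_def h_def subspace_add[OF subspace_V] subspace_scale[OF subspace_V]
        left_translate_plus left_translate_scaleR)
  moreover have "h g ` V = V"
  proof
    show "h g ` V \<subseteq> V" by (auto simp: h_def V_translate)
    show "V \<subseteq> h g ` V"
    proof
      fix w assume w: "w \<in> V"
      have "w = h g (left_translate (- g) w)"
        by (simp add: h_def V_translate[OF w] left_translate_add[symmetric] left_translate_0)
      then show "w \<in> h g ` V" using V_translate[OF w] by blast
    qed
  qed
  moreover have "N (h g w) = N w" if "w \<in> V" for w
    using that by (simp add: h_def N_translate V_V0)
  ultimately show ?thesis by (simp add: Iso_def h_def)
qed

lemma continuous_corep_h: "continuous_corep V N h"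
  unfolding continuous_corep_def
proof (intro conjI allI)
  show "h g \<in> Iso V N" for g by (rule h_Iso)
  show "h (g1 + g2) = compose V (h g2) (h g1)" for g1 g2
    by (rule ext) (simp add: h_def compose_def V_translate left_translate_add restrict_def)
  have "continuous_map euclidean (Metric_space.mtopology V (norm_dist V N)) (\<lambda>g. h g w)" if w: "w \<in> V" for w
  proof (rule continuous_map_euclidean_metricI[OF Metric_space_V])
    show "h g w \<in> V" for g using w by (simp add: h_def V_translate)
    show "\<forall>\<^sub>F u in nhds g. norm_dist V N (h g w) (h u w) < \<epsilon>" if "\<epsilon> > 0" for g \<epsilon>
      using eventually_N_translate[OF w that, of g] w by (simp add: h_def norm_dist_eq V_translate)
  qed
  then show "continuous_map euclidean (strong_operator_topology V N) h"
    unfolding strong_operator_topology_def continuous_map_in_subtopology continuous_map_componentwise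
    using h_Iso by (auto simp: h_def)
qed

sublocale rep: banach_corep V N h
  using banach_space_on_V continuous_corep_h by unfold_locales

lemma norm_diff_bound:
  assumes "w \<in> V0" "\<phi> \<in> M" "\<theta> \<in> M"
  shows "\<bar>\<phi> w - \<theta> w\<bar> \<le> N w * sqrt (orbit_dist \<phi> \<theta>)"
  using boundD(3)[OF V0_bound] assms by blast

lemma restrict_limit_evaluation_in_dual:
  assumes "\<phi> \<in> M"
  shows "restrict \<phi> V \<in> dual V N"
proof -
  have "\<bar>\<phi> w\<bar> \<le> 1 * N w" if "w \<in> V" for w
    using limit_evaluations_le_norm[OF assms, of w] norm_le_N[OF V_V0[OF that]] by simp
  then have "\<exists>B. \<forall>w\<in>V. \<bar>restrict \<phi> V w\<bar> \<le> B * N w" by (intro exI[of _ 1]) simp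
  moreover have "linear_within V (restrict \<phi> V)"
    by (simp add: linear_within_def subspace_add[OF subspace_V] subspace_scale[OF subspace_V]
        limit_evaluations_add[OF assms] limit_evaluations_scaleR[OF assms])
  ultimately show ?thesis by (simp add: dual_def)
qed

text \<open>Evaluation at the neutral element is chosen because its orbit consists of all point
  evaluations and its matrix coefficient with \<open>w\<close> is \<open>w\<close> itself.\<close>

definition \<psi> :: "('g \<Rightarrow>\<^sub>C real) \<Rightarrow> real" where
  "\<psi> = restrict (\<lambda>w. apply_bcontfun w 0) V"

lemma \<psi>_dual: "\<psi> \<in> dual V N"
  unfolding \<psi>_def by (rule restrict_limit_evaluation_in_dual[OF evaluation_in_limit_evaluations])

lemma dual_action_\<psi>: "dual_action V h g \<psi> = restrict (\<lambda>w. apply_bcontfun w g) V"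
  by (rule ext) (simp add: dual_action_def \<psi>_def h_def V_translate restrict_def)

text \<open>The restrictions of elements of \<open>M\<close> form a compact, hence closed, set
  containing the orbit. Elements of the orbit closure thus extend to limit evaluations on all of
  \<open>C(G)\<close>, to which \<open>orbit_dist\<close> applies.\<close>

lemma orbit_closure_\<psi>:
  assumes "\<phi> \<in> orbit_closure V N h \<psi>"
  obtains \<theta> where "\<theta> \<in> M" "\<phi> = restrict \<theta> V"
proof -
  let ?X = "product_topology (\<lambda>_. euclideanreal) V"
  have "continuous_map euclidean ?X (\<lambda>\<theta>. restrict \<theta> V)"
    unfolding continuous_map_componentwise by (auto simp: continuous_map_eval)
  moreover have "compactin euclidean M" using compact_limit_evaluations by simp
  ultimately have "compactin ?X ((\<lambda>\<theta>. restrict \<theta> V) ` M)" by (rule image_compactin[rotated])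
  moreover have "Hausdorff_space ?X" by (simp add: Hausdorff_space_product_topology)
  ultimately have "closedin ?X ((\<lambda>\<theta>. restrict \<theta> V) ` M)" using compactin_imp_closedin by blast
  moreover have "range (\<lambda>g. dual_action V h g \<psi>) \<subseteq> (\<lambda>\<theta>. restrict \<theta> V) ` M"
    unfolding dual_action_\<psi> using evaluation_in_limit_evaluations by blast
  ultimately have "orbit_closure V N h \<psi> \<subseteq> (\<lambda>\<theta>. restrict \<theta> V) ` M"
    unfolding rep.orbit_closure_eq(1)[OF \<psi>_dual] by (rule closure_of_minimal[rotated])
  with assms that show thesis by blast
qed

text \<open>The orbit itself suffices: two distinct functions differ under some point
  evaluation.\<close>

lemma separates_points_\<psi>: "separates_points (orbit_closure V N h \<psi>) V"
  unfolding separates_points_def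
proof (intro ballI impI)
  fix w z assume wz: "w \<in> V" "z \<in> V" "w \<noteq> z"
  then obtain x where x: "apply_bcontfun w x \<noteq> apply_bcontfun z x" using bcontfun_eqI by blast
  have "dual_action V h x \<psi> \<in> orbit_closure V N h \<psi>"
    unfolding rep.orbit_closure_eq(1)[OF \<psi>_dual]
    by (rule subsetD[OF closure_of_subset]) (auto simp: dual_action_def)
  moreover have "dual_action V h x \<psi> w \<noteq> dual_action V h x \<psi> z"
    using wz x by (simp add: dual_action_\<psi>)
  ultimately show "\<exists>\<phi>\<in>orbit_closure V N h \<psi>. \<phi> w \<noteq> \<phi> z" by blast
qed

text \<open>For \<open>k x = \<phi> (left_translate x f)\<close>, a member of the hull, the
  \<open>orbit_dist\<close> between the translates of \<open>\<phi>\<close> by \<open>g\<close> and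
  \<open>u\<close> is the supremum of \<open>\<bar>k (x + g) - k (x + u)\<bar>\<close>. The second
  clause of the criterion makes it small, and the Hoelder bound transfers this to all of
  \<open>V\<close>.\<close>

lemma norm_G_continuous_limit_evaluation:
  assumes crit: "SUC_criterion f" and \<phi>: "\<phi> \<in> M"
  shows "norm_G_continuous V N h (restrict \<phi> V)"
proof (rule rep.norm_G_continuousI[OF restrict_limit_evaluation_in_dual[OF \<phi>]])
  fix g :: 'g and \<epsilon> :: real assume \<epsilon>: "\<epsilon> > 0"
  define k where "k x = \<phi> (left_translate x f)" for x
  have "k \<in> right_hull f" using limit_evaluations_right_hull[OF \<phi>] by (simp add: k_def[abs_def])
  \<comment> \<open>The square compensates for the exponent \<open>1/2\<close>.\<close>
  then have unif: "\<forall>\<^sub>F v in nhds 0. \<forall>x. \<bar>k (x + v) - k x\<bar> < \<epsilon>\<^sup>2"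
    using crit \<epsilon> unfolding SUC_criterion_def by simp
  have "((\<lambda>u. - g + u) \<longlongrightarrow> - g + g) (nhds g)" by (intro tendsto_intros filterlim_ident)
  then have "((\<lambda>u. - g + u) \<longlongrightarrow> 0) (nhds g)" by simp
  from eventually_compose_filterlim[OF unif this]
  show "\<forall>\<^sub>F u in nhds g. \<forall>w\<in>V. \<bar>restrict \<phi> V (h g w) - restrict \<phi> V (h u w)\<bar> \<le> \<epsilon> * N w"
  proof eventually_elim
    case (elim u)
    let ?g = "\<lambda>w. \<phi> (left_translate g w)" and ?u = "\<lambda>w. \<phi> (left_translate u w)"
    have "orbit_dist ?g ?u \<le> \<epsilon>\<^sup>2"
    proof (rule orbit_dist_le)
      fix x
      have "\<bar>k (x + g + (- g + u)) - k (x + g)\<bar> < \<epsilon>\<^sup>2" using elim by blast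
      moreover have "x + g + (- g + u) = x + u" by (simp add: add.assoc)
      ultimately show "\<bar>?g (left_translate x f) - ?u (left_translate x f)\<bar> \<le> \<epsilon>\<^sup>2"
        by (simp add: k_def left_translate_add[symmetric] abs_minus_commute)
    qed
    then have "sqrt (orbit_dist ?g ?u) \<le> \<epsilon>" using \<epsilon> by (simp add: real_le_lsqrt)
    show ?case
    proof
      fix w assume w: "w \<in> V"
      have "\<bar>?g w - ?u w\<bar> \<le> N w * sqrt (orbit_dist ?g ?u)"
        by (intro norm_diff_bound V_V0 w limit_evaluations_translate \<phi>)
      also have "\<dots> \<le> N w * \<epsilon>"
        by (intro mult_left_mono N_nonneg V_V0 w) fact
      finally show "\<bar>restrict \<phi> V (h g w) - restrict \<phi> V (h u w)\<bar> \<le> \<epsilon> * N w"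
        using w by (simp add: h_def V_translate mult.commute)
    qed
  qed
qed

text \<open>
  The exponent 1/2 is used here: differences of translates of \<open>f\<close> are both Lipschitz for
  \<^const>\<open>orbit_dist\<close> and uniformly small, so by interpolation their Hoelder constants are small.
\<close>

lemma f_in_V:
  assumes crit: "SUC_criterion f"
  shows "f \<in> V"
proof (rule V_I)
  \<comment> \<open>Half of \<open>d\<close> is at most the minimum of \<open>\<delta>\<close> and
    \<open>D\<close>, which is at most their geometric mean.\<close>
  have interpolate: "d \<le> 2 * sqrt \<delta> * sqrt D" if "d \<le> 2 * \<delta>" "d \<le> 2 * D" "0 \<le> \<delta>" "0 \<le> D" for d \<delta> D :: real
  proof -
    have "min \<delta> D * min \<delta> D \<le> \<delta> * D" using that by (intro mult_mono) auto
    then have "min \<delta> D \<le> sqrt (\<delta> * D)" by (intro real_le_rsqrt) (simp add: power2_eq_square)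
    then show ?thesis using that(1,2) by (simp add: real_sqrt_mult)
  qed
  \<comment> \<open>\<open>f\<close> varies by at most \<open>orbit_dist\<close> and by at most
    \<open>2 * norm f\<close>, so interpolation gives the Hoelder constant
    \<open>2 * sqrt (norm f)\<close>; the other summand covers the sup norm.\<close>
  have "bound f (norm f + 2 * sqrt (norm f))"
  proof (rule boundI)
    show "norm f \<le> norm f + 2 * sqrt (norm f)" by simp
    fix \<phi> \<theta> assume \<phi>: "\<phi> \<in> M" and \<theta>: "\<theta> \<in> M"
    note D = orbit_dist_bounds[OF \<phi> \<theta>]
    have "\<bar>\<phi> f - \<theta> f\<bar> \<le> orbit_dist \<phi> \<theta>" using D(1)[of 0] by (simp add: left_translate_0)
    with D(2,3) have "\<bar>\<phi> f - \<theta> f\<bar> \<le> 2 * sqrt (norm f) * sqrt (orbit_dist \<phi> \<theta>)"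
      by (intro interpolate) auto
    also have "\<dots> \<le> (norm f + 2 * sqrt (norm f)) * sqrt (orbit_dist \<phi> \<theta>)"
      using D(2) by (intro mult_right_mono) auto
    finally show "\<bar>\<phi> f - \<theta> f\<bar> \<le> (norm f + 2 * sqrt (norm f)) * sqrt (orbit_dist \<phi> \<theta>)" .
  qed
  then show "f \<in> V0" by (rule V0_I)
  \<comment> \<open>The difference of translates is Lipschitz with constant \<open>2\<close> and has
    sup norm at most \<open>\<delta>\<close>, so its Hoelder constant is of order
    \<open>sqrt \<delta>\<close> and vanishes with \<open>\<delta>\<close>.\<close>
  have small: "N (left_translate u f - f) \<le> \<delta> + 2 * sqrt \<delta>"
    if \<delta>: "norm (left_translate u f - f) \<le> \<delta>" for u \<delta>
  proof (rule N_le, rule boundI)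
    have pos: "\<delta> \<ge> 0" using \<delta> norm_ge_zero order_trans by blast
    then show "norm (left_translate u f - f) \<le> \<delta> + 2 * sqrt \<delta>"
      using \<delta> real_sqrt_ge_zero[of \<delta>] by linarith
    fix \<phi> \<theta> assume \<phi>: "\<phi> \<in> M" and \<theta>: "\<theta> \<in> M"
    note D = orbit_dist_bounds[OF \<phi> \<theta>]
    let ?d = "left_translate u f - f"
    have "\<bar>\<phi> ?d\<bar> \<le> \<delta>" "\<bar>\<theta> ?d\<bar> \<le> \<delta>"
      using limit_evaluations_le_norm[OF \<phi>, of ?d] limit_evaluations_le_norm[OF \<theta>, of ?d] \<delta> by linarith+
    then have "\<bar>\<phi> ?d - \<theta> ?d\<bar> \<le> 2 * \<delta>" by linarith
    moreover have "\<bar>\<phi> ?d - \<theta> ?d\<bar> \<le> 2 * orbit_dist \<phi> \<theta>"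
      using D(1)[of u] D(1)[of 0]
      by (simp add: left_translate_0 limit_evaluations_diff[OF \<phi>] limit_evaluations_diff[OF \<theta>])
    ultimately have "\<bar>\<phi> ?d - \<theta> ?d\<bar> \<le> 2 * sqrt \<delta> * sqrt (orbit_dist \<phi> \<theta>)"
      using pos D(2) by (rule interpolate)
    also have "\<dots> \<le> (\<delta> + 2 * sqrt \<delta>) * sqrt (orbit_dist \<phi> \<theta>)"
      using D(2) pos by (intro mult_right_mono) auto
    finally show "\<bar>\<phi> ?d - \<theta> ?d\<bar> \<le> (\<delta> + 2 * sqrt \<delta>) * sqrt (orbit_dist \<phi> \<theta>)" .
  qed
  fix \<epsilon> :: real assume \<epsilon>: "\<epsilon> > 0"
  have "((\<lambda>\<delta>. \<delta> + 2 * sqrt \<delta>) \<longlongrightarrow> 0 + 2 * sqrt 0) (at_right 0)"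
    by (intro tendsto_intros)
  then have "\<forall>\<^sub>F \<delta> in at_right 0. \<delta> + 2 * sqrt \<delta> < \<epsilon>" using \<epsilon> by (intro order_tendstoD(2)[of _ 0]) auto
  then have "\<forall>\<^sub>F \<delta> in at_right 0. 0 < \<delta> \<and> \<delta> + 2 * sqrt \<delta> < \<epsilon>"
    using eventually_at_right_less[of 0] by eventually_elim simp
  then obtain \<delta> where \<delta>: "\<delta> > 0" "\<delta> + 2 * sqrt \<delta> < \<epsilon>"
    using eventually_happens'[OF trivial_limit_at_right_real] by blast
  have "\<forall>\<^sub>F u in nhds 0. \<forall>x. \<bar>apply_bcontfun f (u + x) - apply_bcontfun f x\<bar> < \<delta>"
    using crit \<delta>(1) unfolding SUC_criterion_def by blast
  then show "\<forall>\<^sub>F u in nhds 0. N (left_translate u f - f) < \<epsilon>"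
  proof eventually_elim
    case (elim u)
    have "norm (left_translate u f - f) \<le> \<delta>"
      by (rule norm_bound) (use elim in \<open>simp add: less_imp_le\<close>)
    from small[OF this] \<delta>(2) show ?case by linarith
  qed
qed

text \<open>The vector is \<open>f\<close> itself: translating it by \<open>g\<close> and evaluating
  at \<open>0\<close> returns the value of \<open>f\<close> at \<open>g\<close>.\<close>

lemma representation:
  assumes "SUC_criterion f"
  shows "SUC_representation V N h f \<psi> f"
  unfolding SUC_representation_def
proof (intro conjI ballI)
  show "norm_G_continuous V N h \<phi>" if "\<phi> \<in> orbit_closure V N h \<psi>" for \<phi>
    using orbit_closure_\<psi>[OF that] norm_G_continuous_limit_evaluation[OF assms] by metis
  show "apply_bcontfun f = matrix_coefficient h f \<psi>"
    using f_in_V[OF assms] by (simp add: fun_eq_iff matrix_coefficient_def h_def \<psi>_def V_translate)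
qed (fact banach_space_on_V continuous_corep_h f_in_V[OF assms] \<psi>_dual)+

end

lemma SUC_criterion_imp_representation:
  fixes f :: "'g::topological_group_add \<Rightarrow>\<^sub>C real"
  assumes "SUC_criterion f"
  shows "\<exists>(V :: ('g \<Rightarrow>\<^sub>C real) set) N h v \<psi>. SUC_representation V N h v \<psi> f \<and>
           separates_points (orbit_closure V N h \<psi>) V"
  using holder_space.representation[OF assms] holder_space.separates_points_\<psi>[of f] by blast

text \<open>The criterion mentions no space \<open>Y\<close>, and it follows from a factorization
  through a space of any type. This settles the type-independent claims of the theorem.\<close>

lemma SUC_iff_criterion: "f \<in> SUC \<longleftrightarrow> SUC_criterion f"
  unfolding SUC_def
  using SUC_criterion_imp_SUC[of f] SUC_factorization_imp_criterion by (auto simp: SUC_def)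

theorem theorem9p8:
  fixes f :: "'g::topological_group_add \<Rightarrow>\<^sub>C real"
  shows "(f \<in> SUC \<longleftrightarrow>
            (\<exists>(V :: ('g \<Rightarrow>\<^sub>C real) set) N h v \<psi>. SUC_representation V N h v \<psi> f)) \<and>
         (f \<in> SUC \<longleftrightarrow>
            (\<exists>(V :: ('g \<Rightarrow>\<^sub>C real) set) N h v \<psi>. SUC_representation V N h v \<psi> f \<and>
               separates_points (orbit_closure V N h \<psi>) V)) \<and>
         \<comment> \<open>the same for compact spaces and Banach spaces on arbitrary types\<close>
         (\<forall>(Y :: 'y topology) act \<nu> F. SUC_factorization Y act \<nu> F f \<longrightarrow> f \<in> SUC) \<and>
         (\<forall>(V :: 'v::real_vector set) N h v \<psi>. SUC_representation V N h v \<psi> f \<longrightarrow> f \<in> SUC)"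
proof (intro conjI allI impI)
  show "f \<in> SUC \<longleftrightarrow> (\<exists>(V :: ('g \<Rightarrow>\<^sub>C real) set) N h v \<psi>. SUC_representation V N h v \<psi> f)"
    using SUC_criterion_imp_representation[of f] SUC_representation_imp_criterion
    unfolding SUC_iff_criterion by blast
  show "f \<in> SUC \<longleftrightarrow> (\<exists>(V :: ('g \<Rightarrow>\<^sub>C real) set) N h v \<psi>. SUC_representation V N h v \<psi> f \<and>
               separates_points (orbit_closure V N h \<psi>) V)"
    using SUC_criterion_imp_representation[of f] SUC_representation_imp_criterion
    unfolding SUC_iff_criterion by blast
  show "f \<in> SUC" if "SUC_factorization Y act \<nu> F f"
    for Y :: "'y topology" and act \<nu> F
    using SUC_factorization_imp_criterion[OF that] by (simp only: SUC_iff_criterion)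
  show "f \<in> SUC" if "SUC_representation V N h v \<psi> f"
    for V :: "'v set" and N h v \<psi>
    using SUC_representation_imp_criterion[OF that] by (simp only: SUC_iff_criterion)
qed

end
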